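(* Let $d\ge 1$ and let $\gamma_d$ be the standard Gaussian measure on $\mathbb{R}^d$. Let $V,W:\mathbb{R}^d\to\mathbb{R}\cup\{+\infty\}$ be convex functions such that $\mu(dx)=e^{V(x)}\gamma_d(dx)$ and $\nu(dx)=e^{-W(x)}\gamma_d(dx)$ are probability measures on $\mathbb{R}^d$. Assume further that $\mu$ has a finite second moment and that $\nu$ is compactly supported. Then there exists a continuously differentiable and convex function $\phi:\mathbb{R}^d\to\mathbb{R}$ such that $\nabla\phi$ is $1$-Lipschitz and $\nu=\nabla\phi_{\#}\mu$.
   Context: $\mathbb{R}^d$ carries the standard Euclidean norm. Convex functions are allowed to take the value $+\infty$ (with $e^{-\infty}=0$). $T_{\#}\mu$ denotes the push-forward of $\mu$ under $T$. *)

theory Defs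
  imports "HOL-Probability.Probability"
begin

definition std_gaussian :: "(real ^ 'n) measure" where
  "std_gaussian = density lborel
     (\<lambda>x. ennreal (exp (- (norm x)\<^sup>2 / 2) / sqrt (2 * pi) ^ CARD('n)))"

definition exp_ereal :: "ereal \<Rightarrow> ennreal" where
  "exp_ereal a = (case a of ereal r \<Rightarrow> ennreal (exp r) | PInfty \<Rightarrow> \<infinity> | MInfty \<Rightarrow> 0)"

text \<open>
  Convex functions with values in \<open>\<real> \<union> {+\<infinity>}\<close>. Excluding \<open>-\<infinity>\<close> and taking \<open>0 < t < 1\<close>
  keeps the right-hand side of the inequality free of the conventions for \<open>\<infinity> - \<infinity>\<close>
  and \<open>0 * \<infinity>\<close>.
\<close>
definition ext_convex :: "('a::real_vector \<Rightarrow> ereal) \<Rightarrow> bool" where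
  "ext_convex f \<longleftrightarrow>
     (\<forall>x. f x \<noteq> -\<infinity>) \<and>
     (\<forall>x y. \<forall>t::real. 0 < t \<and> t < 1 \<longrightarrow>
        f ((1 - t) *\<^sub>R x + t *\<^sub>R y) \<le> ereal (1 - t) * f x + ereal t * f y)"

text \<open>
  The measure \<open>f(x) std_gaussian(dx)\<close> on the Borel sets will be written \<open>density std_gaussian f\<close>
  with no measurability assumption on \<open>f\<close>. An extended-valued convex function need not
  be Borel measurable (its values on the boundary of its domain are nearly arbitrary), but it
  is Lebesgue measurable. For such functions \<open>density\<close> is still the intended measure,
  because \<open>nn_integral\<close> agrees with the integral over the completed measure
  (\<open>nn_integral_completion\<close>).
\<close>

definition measure_support :: "'a::topological_space measure \<Rightarrow> 'a set" where
  "measure_support M = {x. \<forall>U. open U \<and> x \<in> U \<longrightarrow> 0 < emeasure M U}"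

end

theory Submission
  imports Defs "HOL-Complex_Analysis.Great_Picard"
begin

text \<open>
  The theorem is Caffarelli's contraction theorem. The transport map is obtained as a limit of barycentric maps
  of entropic couplings, so that neither the regularity theory of the Monge-Ampere equation nor the existence
  of optimal transport maps is involved.

  Write \<open>\<mu> = exp (- m) dx\<close> and \<open>\<nu> = exp (- w) dy\<close> on an open bounded convex set \<open>U\<close>. The hypotheses say that
  the symmetric second differences \<open>m (x + u) + m (x - u) - 2 * m x\<close> are at most \<open>(norm u)\<^sup>2\<close>, and those of \<open>w\<close>
  are at least \<open>(norm u)\<^sup>2\<close>. For a temperature \<open>e > 0\<close>, an entropic coupling has the density
  \<open>exp ((x \<bullet> y - \<phi> x - \<psi> y) / e)\<close> with respect to the product of \<open>\<mu>\<close> and \<open>\<nu>\<close>. Prescribing the first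
  marginal \<open>\<mu>\<close> means that \<open>\<phi>\<close> is a soft Legendre transform of \<open>\<psi>\<close>, and prescribing the second marginal \<open>\<nu>\<close>
  means that \<open>\<psi>\<close> is one of \<open>\<phi>\<close>.

  Curvature bounds pass through these transforms. If \<open>\<psi>\<close> has curvature at least \<open>a\<close>, the
  Prekopa-Leindler inequality shows that \<open>\<phi>\<close> has curvature at most \<open>1 / (a + e)\<close>
  (\<open>soft_conjugate_second_difference_le\<close>). If \<open>\<phi>\<close> has curvature at most \<open>c\<close>, the Cauchy-Schwarz
  inequality shows that its transform has curvature at least \<open>1 / (c + e)\<close>
  (\<open>soft_conjugate_second_difference_ge\<close>). Hence the potentials \<open>\<psi>\<close> with curvature at least \<open>1 / (1 + e)\<close>
  form a class that is invariant under Sinkhorn steps, and their transforms have curvature at most 1.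

  An exact solution of the two marginal equations is not required. The dual objective is bounded below
  on the invariant class, and a Sinkhorn step decreases it at least by \<open>e\<close> times the relative entropy
  between \<open>\<nu>\<close> and the second marginal. So a potential close to the infimum has a second marginal close to
  \<open>\<nu>\<close> in total variation (\<open>ex_nearly_exact_second_marginal\<close>).

  For such a potential let \<open>T x\<close> be the mean of \<open>y\<close> under the coupling, given \<open>x\<close>. It is a
  subgradient of \<open>\<phi>\<close> at \<open>x\<close>, so the curvature bound makes \<open>T\<close> nonexpansive. As \<open>\<phi>\<close> is also a logarithmic moment
  generating function, the same bound makes the conditional variance of \<open>y\<close> of order \<open>e\<close>
  (\<open>plan_mean_deviation\<close>). Hence \<open>T\<close> transports \<open>\<mu>\<close> almost to \<open>\<nu>\<close> (\<open>ex_approximate_map\<close>). As \<open>e\<close> tends to 0,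
  a subsequence of the pairs \<open>(\<phi>, T)\<close> converges pointwise to a convex function and its gradient
  (\<open>smooth_convex_compactness\<close>), and the limit transports \<open>\<mu>\<close> exactly to \<open>\<nu>\<close> (\<open>contraction_transport\<close>).

  It remains to bring the data into this form. Finiteness of the total mass forces \<open>V\<close> to be finite everywhere,
  and \<open>W\<close> may be modified on the frontier of its domain, which is a null set. The compact support
  of \<open>\<nu>\<close> makes the interior of that domain bounded.
\<close>

section \<open>Midpoint Prekopa-Leindler inequality\<close>

text \<open>
  A set need not contain its supremum, so the measure of the whole set is reached along cut-off points
  \<open>t n\<close> that increase to the supremum, or to infinity. The constant \<open>c\<close> allows the lemma to be applied to two sets
  one after the other.
\<close>
lemma emeasure_le_if_initial_parts_le:
  fixes A :: "real set" and c K :: ennreal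
  assumes A: "A \<in> sets borel" "A \<noteq> {}"
    and le: "\<And>a. a \<in> A \<Longrightarrow> emeasure lborel (A \<inter> {..a}) + c \<le> K"
  shows "emeasure lborel A + c \<le> K"
proof -
  define t where "t n = (if bdd_above A then Sup A - 1 / real (Suc n) else real n)" for n
  have t: "\<exists>a\<in>A. t n \<le> a" for n
  proof (cases "bdd_above A")
    case True
    have "t n < Sup A" using True by (simp add: t_def)
    then show ?thesis using True A by (meson less_cSup_iff less_imp_le)
  next
    case False
    then have "\<exists>a\<in>A. \<not> a \<le> t n" unfolding bdd_above_def by blast
    then show ?thesis by (meson linear)
  qed
  have "incseq t"
    unfolding t_def by (intro incseq_SucI) (auto simp: field_simps)
  have "A - {Sup A} \<subseteq> (\<Union>n. A \<inter> {..t n})"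
  proof
    fix x assume x: "x \<in> A - {Sup A}"
    show "x \<in> (\<Union>n. A \<inter> {..t n})"
    proof (cases "bdd_above A")
      case True
      then have "x < Sup A" using x cSup_upper[of x A] by force
      then obtain n where "inverse (real (Suc n)) < Sup A - x"
        using reals_Archimedean[of "Sup A - x"] by auto
      then have "x \<le> t n" using True by (simp add: t_def inverse_eq_divide)
      then show ?thesis using x by auto
    next
      case False
      obtain n where "x \<le> real n" using real_arch_simple by blast
      then show ?thesis using x False by (auto simp: t_def)
    qed
  qed
  then have "A \<subseteq> (\<Union>n. A \<inter> {..t n}) \<union> {Sup A}" by auto
  then have "emeasure lborel A \<le> emeasure lborel ((\<Union>n. A \<inter> {..t n}) \<union> {Sup A})"
    using A by (intro emeasure_mono) auto
  also have "\<dots> \<le> emeasure lborel (\<Union>n. A \<inter> {..t n}) + emeasure lborel {Sup A}"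
    using A by (intro emeasure_subadditive) auto
  also have "\<dots> = (SUP n. emeasure lborel (A \<inter> {..t n}))"
  proof (subst SUP_emeasure_incseq)
    show "incseq (\<lambda>n. A \<inter> {..t n})"
      using \<open>incseq t\<close> by (auto simp: incseq_def intro: order_trans)
  qed (use A in auto)
  finally have "emeasure lborel A + c \<le> (SUP n. emeasure lborel (A \<inter> {..t n})) + c"
    by (intro add_right_mono)
  also have "\<dots> = (SUP n. emeasure lborel (A \<inter> {..t n}) + c)"
    by (rule ennreal_SUP_add_left[symmetric]) auto
  also have "\<dots> \<le> K"
  proof (rule SUP_least)
    fix n
    obtain a where a: "a \<in> A" "t n \<le> a" using t by blast
    have "emeasure lborel (A \<inter> {..t n}) \<le> emeasure lborel (A \<inter> {..a})"
      using A a by (intro emeasure_mono) auto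
    then show "emeasure lborel (A \<inter> {..t n}) + c \<le> K"
      using le[OF a(1)] by (meson add_right_mono order_trans)
  qed
  finally show ?thesis .
qed

lemma emeasure_lborel_affine_vimage:
  fixes A :: "real set"
  assumes [measurable]: "A \<in> sets borel" and c: "c \<noteq> 0"
  shows "emeasure lborel A = ennreal \<bar>c\<bar> * emeasure lborel {x. t + c * x \<in> A}"
proof -
  have "emeasure lborel A = (\<integral>\<^sup>+x. indicator A x \<partial>lborel)" by simp
  also have "\<dots> = \<bar>c\<bar> * (\<integral>\<^sup>+x. indicator A (t + c * x) \<partial>lborel)"
    using c by (intro nn_integral_real_affine) auto
  also have "(\<integral>\<^sup>+x. indicator A (t + c * x) \<partial>lborel) = (\<integral>\<^sup>+x. indicator {x. t + c * x \<in> A} x \<partial>lborel)"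
    by (intro nn_integral_cong) (auto simp: indicator_def)
  also have "\<dots> = emeasure lborel {x. t + c * x \<in> A}" by simp
  finally show ?thesis .
qed

text \<open>
  Cut \<open>A\<close> from above at a point \<open>a \<in> A\<close> and \<open>B\<close> from below at \<open>b \<in> B\<close>. The translates of the two
  pieces by \<open>b\<close> and by \<open>a\<close> both lie in \<open>{s. s / 2 \<in> C}\<close> and meet at most in \<open>a + b\<close>, hence
  their measures add up. Requiring a measurable \<open>C\<close> that contains the midpoints, instead of
  taking the set of midpoints itself, avoids the question whether that set is measurable.
\<close>
lemma brunn_minkowski_line:
  fixes A B C :: "real set"
  assumes [measurable]: "A \<in> sets borel" "B \<in> sets borel" "C \<in> sets borel"
    and ne: "A \<noteq> {}" "B \<noteq> {}"
    and mid: "\<And>a b. a \<in> A \<Longrightarrow> b \<in> B \<Longrightarrow> (a + b) / 2 \<in> C"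
  shows "emeasure lborel A + emeasure lborel B \<le> 2 * emeasure lborel C"
proof -
  let ?l = "emeasure lborel"
  have parts: "?l (A \<inter> {..a}) + ?l (B \<inter> {b..}) \<le> 2 * ?l C" if ab: "a \<in> A" "b \<in> B" for a b
  proof -
    define A' where "A' = {s. - b + 1 * s \<in> A \<inter> {..a}}"
    define B' where "B' = {s. - a + 1 * s \<in> B \<inter> {b..}}"
    have [measurable]: "A' \<in> sets borel" "B' \<in> sets borel"
      unfolding A'_def B'_def by measurable
    have "?l (A \<inter> {..a}) + ?l (B \<inter> {b..}) = ?l A' + ?l B'"
      unfolding A'_def B'_def
      using emeasure_lborel_affine_vimage[of "A \<inter> {..a}" 1 "-b"]
        emeasure_lborel_affine_vimage[of "B \<inter> {b..}" 1 "-a"] by simp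
    also have "\<dots> = ?l (A' - {a + b}) + ?l B'"
      by (simp add: emeasure_Diff_null_set finite_imp_null_set_lborel)
    also have "\<dots> = ?l ((A' - {a + b}) \<union> B')"
      by (intro plus_emeasure) (auto simp: A'_def B'_def)
    also have "\<dots> \<le> ?l {s. 0 + (1/2) * s \<in> C}"
    proof (rule emeasure_mono)
      show "A' - {a + b} \<union> B' \<subseteq> {s. 0 + (1/2) * s \<in> C}"
        using mid[of _ b] mid[of a] ab by (fastforce simp: A'_def B'_def)
    qed measurable
    also have "\<dots> = 2 * (ennreal (1/2) * ?l {s. 0 + (1/2) * s \<in> C})"
    proof -
      have "2 * ennreal (1/2) = ennreal (2 * (1/2))" by (subst ennreal_mult) auto
      then have e: "2 * ennreal (1/2) = 1" by simp
      show ?thesis by (subst mult.assoc[symmetric], subst e, rule mult_1[symmetric])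
    qed
    also have "\<dots> = 2 * ?l C"
      using emeasure_lborel_affine_vimage[of C "1/2" 0] by simp
    finally show ?thesis .
  qed
  have A_part: "?l A + ?l (B \<inter> {b..}) \<le> 2 * ?l C" if "b \<in> B" for b
    by (rule emeasure_le_if_initial_parts_le[OF _ ne(1)]) (use parts that in auto)
  let ?B = "{x. 0 + (-1) * x \<in> B}"
  have "?l ?B + ?l A \<le> 2 * ?l C"
  proof (rule emeasure_le_if_initial_parts_le)
    show "?B \<in> sets borel" by measurable
    show "?B \<noteq> {}" 
    proof -
      obtain b where "b \<in> B" using ne by blast
      then have "- b \<in> ?B" by simp
      then show ?thesis by blast
    qed
    fix b assume b: "b \<in> ?B"
    have "?B \<inter> {..b} = {x. 0 + (-1) * x \<in> B \<inter> {-b..}}" by auto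
    then have "?l (?B \<inter> {..b}) = ?l (B \<inter> {-b..})"
      using emeasure_lborel_affine_vimage[of "B \<inter> {-b..}" "-1" 0] by simp
    then show "?l (?B \<inter> {..b}) + ?l A \<le> 2 * ?l C"
      using A_part[of "-b"] b by (simp add: add.commute)
  qed
  then show ?thesis
    using emeasure_lborel_affine_vimage[of B "-1" 0] by (simp add: add.commute)
qed

lemma nn_integral_layer_cake:
  fixes f :: "real \<Rightarrow> ennreal"
  assumes [measurable]: "f \<in> borel_measurable borel" and le: "\<And>x. f x \<le> 1"
  shows "(\<integral>\<^sup>+x. f x \<partial>lborel) =
    (\<integral>\<^sup>+l. indicator {0<..<1} l * emeasure lborel {x. ennreal l < f x} \<partial>lborel)"
proof -
  have f_eq: "f x = (\<integral>\<^sup>+l. indicator {0<..<1} l * indicator {x. ennreal l < f x} x \<partial>lborel)" for x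
  proof -
    obtain r where r: "f x = ennreal r" "0 \<le> r" "r \<le> 1"
      using le[of x] by (cases "f x") (auto simp: top_unique)
    have "(\<integral>\<^sup>+l. indicator {0<..<1} l * indicator {x. ennreal l < f x} x \<partial>lborel)
        = (\<integral>\<^sup>+l. indicator {0<..<r} l \<partial>lborel)"
      using r by (intro nn_integral_cong) (auto simp: indicator_def ennreal_less_iff)
    also have "\<dots> = f x" using r by simp
    finally show ?thesis by simp
  qed
  have "(\<integral>\<^sup>+x. f x \<partial>lborel) =
      (\<integral>\<^sup>+x. (\<integral>\<^sup>+l. indicator {0<..<1} l * indicator {x. ennreal l < f x} x \<partial>lborel) \<partial>lborel)"
    by (subst f_eq) simp
  also have "\<dots> = (\<integral>\<^sup>+l. (\<integral>\<^sup>+x. indicator {0<..<1} l * indicator {x. ennreal l < f x} x \<partial>lborel) \<partial>lborel)"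
    by (rule lborel_pair.Fubini'[symmetric]) (simp add: indicator_def of_bool_def cong: if_cong, measurable)
  also have "\<dots> = (\<integral>\<^sup>+l. indicator {0<..<1} l * emeasure lborel {x. ennreal l < f x} \<partial>lborel)"
    by (subst nn_integral_cmult) auto
  finally show ?thesis .
qed

lemma ennreal_power2_mono_iff: "a\<^sup>2 \<le> b\<^sup>2 \<longleftrightarrow> a \<le> (b::ennreal)"
proof
  assume *: "a\<^sup>2 \<le> b\<^sup>2"
  show "a \<le> b"
  proof (cases a; cases b)
    fix r s assume "a = ennreal r" "0 \<le> r" "b = ennreal s" "0 \<le> s"
    moreover from this * have "ennreal (r\<^sup>2) \<le> ennreal (s\<^sup>2)" by (simp only: ennreal_power)
    ultimately have "r\<^sup>2 \<le> s\<^sup>2" "0 \<le> s" by (simp_all add: ennreal_le_iff)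
    then have "r \<le> s" by (rule power2_le_imp_le)
    then show ?thesis unfolding \<open>a = _\<close> \<open>b = _\<close> by (rule ennreal_leI)
  qed (use * in \<open>auto simp: top_unique ennreal_power ennreal_top_eq_mult_iff power2_eq_square simp flip: ennreal_mult\<close>)
qed (simp add: power_mono)

text \<open>
  When both suprema are 1, every level below 1 gives nonempty superlevel sets of \<open>f\<close> and \<open>g\<close>. Midpoints
  of their points lie in the superlevel set of \<open>h\<close>, so the Brunn-Minkowski inequality holds level by
  level and can be integrated over the levels.
\<close>
lemma prekopa_leindler_line_normalized:
  fixes f g h :: "real \<Rightarrow> ennreal"
  assumes [measurable]: "f \<in> borel_measurable borel" "g \<in> borel_measurable borel" "h \<in> borel_measurable borel"
    and sup: "(SUP x. f x) = 1" "(SUP x. g x) = 1"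
    and fgh: "\<And>x y. f x * g y \<le> (h ((x + y) / 2))\<^sup>2"
  shows "(\<integral>\<^sup>+x. f x \<partial>lborel) + (\<integral>\<^sup>+x. g x \<partial>lborel) \<le> 2 * (\<integral>\<^sup>+x. h x \<partial>lborel)"
proof -
  define k where "k x = min (h x) 1" for x
  have [measurable]: "k \<in> borel_measurable borel" unfolding k_def by measurable
  have le: "f x \<le> 1" "g x \<le> 1" "k x \<le> 1" for x
    using sup SUP_upper[of x UNIV f] SUP_upper[of x UNIV g] by (auto simp: k_def)
  have fgk: "f x * g y \<le> (k ((x + y) / 2))\<^sup>2" for x y
  proof -
    have "f x * g y \<le> 1" using mult_mono[OF le(1) le(2)] by simp
    then show ?thesis using fgh[of x y] by (auto simp: k_def min_def)
  qed
  have levels: "emeasure lborel {x. ennreal l < f x} + emeasure lborel {x. ennreal l < g x}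
      \<le> 2 * emeasure lborel {x. ennreal l < k x}" if l: "0 < l" "l < 1" for l
  proof (rule brunn_minkowski_line)
    have "ennreal l < (SUP x. f x)" "ennreal l < (SUP x. g x)" using l sup by auto
    then show "{x. ennreal l < f x} \<noteq> {}" "{x. ennreal l < g x} \<noteq> {}" by (auto simp: less_SUP_iff)
    fix a b assume ab: "a \<in> {x. ennreal l < f x}" "b \<in> {x. ennreal l < g x}"
    obtain r s where rs: "f a = ennreal r" "0 \<le> r" "g b = ennreal s" "0 \<le> s"
      using le(1)[of a] le(2)[of b] by (cases "f a"; cases "g b") (auto simp: top_unique)
    have "l < r" "l < s" using ab rs l by (auto simp: ennreal_less_iff)
    then have "l\<^sup>2 < r * s" using l by (simp add: power2_eq_square mult_strict_mono)
    then have "(ennreal l)\<^sup>2 < f a * g b" using rs l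
      by (simp add: ennreal_power ennreal_less_iff flip: ennreal_mult)
    also have "\<dots> \<le> (k ((a + b) / 2))\<^sup>2" by (rule fgk)
    finally have "\<not> (k ((a + b) / 2))\<^sup>2 \<le> (ennreal l)\<^sup>2" by simp
    then show "(a + b) / 2 \<in> {x. ennreal l < k x}"
      by (simp add: ennreal_power2_mono_iff)
  qed measurable
  have "(\<integral>\<^sup>+x. f x \<partial>lborel) + (\<integral>\<^sup>+x. g x \<partial>lborel) =
      (\<integral>\<^sup>+l. indicator {0<..<1} l * emeasure lborel {x. ennreal l < f x}
        + indicator {0<..<1} l * emeasure lborel {x. ennreal l < g x} \<partial>lborel)"
    unfolding nn_integral_layer_cake[OF assms(1) le(1)] nn_integral_layer_cake[OF assms(2) le(2)]
    by (rule nn_integral_add[symmetric]) measurable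
  also have "\<dots> \<le> (\<integral>\<^sup>+l. 2 * (indicator {0<..<1} l * emeasure lborel {x. ennreal l < k x}) \<partial>lborel)"
    using levels by (intro nn_integral_mono) (auto simp: indicator_def)
  also have "\<dots> = 2 * (\<integral>\<^sup>+x. k x \<partial>lborel)"
    by (subst nn_integral_layer_cake[OF _ le(3)]) (auto intro!: nn_integral_cmult)
  also have "\<dots> \<le> 2 * (\<integral>\<^sup>+x. h x \<partial>lborel)"
    by (intro mult_left_mono nn_integral_mono) (auto simp: k_def)
  finally show ?thesis .
qed

lemma ennreal_mult_le_power2_if_add_le:
  fixes a b c :: ennreal
  assumes "a + b \<le> 2 * c"
  shows "a * b \<le> c\<^sup>2"
proof (cases a; cases b; cases c)
  fix r s t assume *: "a = ennreal r" "0 \<le> r" "b = ennreal s" "0 \<le> s" "c = ennreal t" "0 \<le> t"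
  then have "r + s \<le> 2 * t" using assms
    by (simp add: ennreal_le_iff flip: ennreal_plus ennreal_numeral ennreal_mult)
  then have "(r + s)\<^sup>2 \<le> (2 * t)\<^sup>2" using * by (intro power_mono) auto
  then have "r * s \<le> t\<^sup>2" using zero_le_power2[of "r - s"] by (simp add: power2_eq_square algebra_simps)
  with * show ?thesis by (simp add: ennreal_power ennreal_le_iff flip: ennreal_mult)
qed (use assms in \<open>auto simp: top_unique ennreal_mult_eq_top_iff power2_eq_square ennreal_top_mult ennreal_mult_top simp flip: ennreal_numeral ennreal_mult ennreal_plus\<close>)

text \<open>
  Scaling \<open>f\<close> and \<open>g\<close> to supremum 1 and \<open>h\<close> by the geometric mean of the two factors preserves the
  hypothesis. The additive conclusion of the normalized case then becomes multiplicative by the inequality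
  of arithmetic and geometric means, and in this form the scaling factors cancel.
\<close>
lemma prekopa_leindler_line_bounded:
  fixes f g h :: "real \<Rightarrow> ennreal"
  assumes [measurable]: "f \<in> borel_measurable borel" "g \<in> borel_measurable borel" "h \<in> borel_measurable borel"
    and bdd: "(SUP x. f x) < \<infinity>" "(SUP x. g x) < \<infinity>"
    and fgh: "\<And>x y. f x * g y \<le> (h ((x + y) / 2))\<^sup>2"
  shows "(\<integral>\<^sup>+x. f x \<partial>lborel) * (\<integral>\<^sup>+x. g x \<partial>lborel) \<le> (\<integral>\<^sup>+x. h x \<partial>lborel)\<^sup>2"
proof (cases "(SUP x. f x) = 0 \<or> (SUP x. g x) = 0")
  case True
  then have "(\<forall>x. f x = 0) \<or> (\<forall>x. g x = 0)"
    by (metis SUP_upper UNIV_I le_zero_eq)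
  then show ?thesis by auto
next
  case False
  obtain m l where m: "(SUP x. f x) = ennreal m" "0 < m" and l: "(SUP x. g x) = ennreal l" "0 < l"
    using bdd False by (cases "SUP x. f x"; cases "SUP x. g x") (auto simp: less_le)
  define c where "c = 1 / sqrt (m * l)"
  have c: "0 < c" "c\<^sup>2 = (1/m) * (1/l)" using m l by (auto simp: c_def power_divide)
  have c2: "(ennreal c)\<^sup>2 = ennreal (1/m) * ennreal (1/l)"
    using c m l by (simp add: ennreal_power flip: ennreal_mult)
  have "(\<integral>\<^sup>+x. ennreal (1/m) * f x \<partial>lborel) + (\<integral>\<^sup>+x. ennreal (1/l) * g x \<partial>lborel)
      \<le> 2 * (\<integral>\<^sup>+x. ennreal c * h x \<partial>lborel)"
  proof (rule prekopa_leindler_line_normalized)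
    show "(SUP x. ennreal (1/m) * f x) = 1" "(SUP x. ennreal (1/l) * g x) = 1"
      using m l by (subst SUP_mult_left_ennreal[symmetric]; simp flip: ennreal_mult)+
    fix x y
    have "ennreal (1/m) * f x * (ennreal (1/l) * g y) = (ennreal c)\<^sup>2 * (f x * g y)"
      unfolding c2 by (simp only: ac_simps)
    also have "\<dots> \<le> (ennreal c)\<^sup>2 * (h ((x + y) / 2))\<^sup>2"
      by (intro mult_left_mono fgh) auto
    finally show "ennreal (1/m) * f x * (ennreal (1/l) * g y) \<le> (ennreal c * h ((x + y) / 2))\<^sup>2"
      by (simp add: power_mult_distrib)
  qed measurable
  then have "(ennreal (1/m) * (\<integral>\<^sup>+x. f x \<partial>lborel)) * (ennreal (1/l) * (\<integral>\<^sup>+x. g x \<partial>lborel))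
      \<le> (ennreal c * (\<integral>\<^sup>+x. h x \<partial>lborel))\<^sup>2"
    by (intro ennreal_mult_le_power2_if_add_le) (simp add: nn_integral_cmult)
  then have "(ennreal c)\<^sup>2 * ((\<integral>\<^sup>+x. f x \<partial>lborel) * (\<integral>\<^sup>+x. g x \<partial>lborel))
      \<le> (ennreal c)\<^sup>2 * (\<integral>\<^sup>+x. h x \<partial>lborel)\<^sup>2"
    unfolding c2 by (simp add: power_mult_distrib c2 ac_simps)
  then show ?thesis
  proof (subst (asm) ennreal_mult_le_mult_iff)
    show "(ennreal c)\<^sup>2 \<noteq> 0" "(ennreal c)\<^sup>2 \<noteq> top" using c(1) by (auto simp: power2_eq_square ennreal_mult_eq_top_iff)
  qed
qed

lemma nn_integral_le_if_truncations_le: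
  fixes f :: "'a \<Rightarrow> ennreal"
  assumes [measurable]: "f \<in> borel_measurable M"
    and le: "\<And>n::nat. (\<integral>\<^sup>+x. min (f x) (of_nat n) \<partial>M) * c \<le> K"
  shows "(\<integral>\<^sup>+x. f x \<partial>M) * c \<le> K"
proof -
  have "(SUP n::nat. min (f x) (of_nat n)) = f x" for x
    by (simp add: inf_SUP[symmetric] ennreal_SUP_of_nat_eq_top flip: inf_min)
  then have "(\<integral>\<^sup>+x. f x \<partial>M) = (\<integral>\<^sup>+x. (SUP n::nat. min (f x) (of_nat n)) \<partial>M)" by simp
  also have "\<dots> = (SUP n::nat. \<integral>\<^sup>+x. min (f x) (of_nat n) \<partial>M)"
    by (intro nn_integral_monotone_convergence_SUP)
       (auto simp: incseq_def le_fun_def min_le_iff_disj intro!: min.mono)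
  finally show ?thesis
    using le by (simp add: SUP_mult_right_ennreal SUP_le_iff)
qed

lemma prekopa_leindler_line:
  fixes f g h :: "real \<Rightarrow> ennreal"
  assumes [measurable]: "f \<in> borel_measurable borel" "g \<in> borel_measurable borel" "h \<in> borel_measurable borel"
    and fgh: "\<And>x y. f x * g y \<le> (h ((x + y) / 2))\<^sup>2"
  shows "(\<integral>\<^sup>+x. f x \<partial>lborel) * (\<integral>\<^sup>+x. g x \<partial>lborel) \<le> (\<integral>\<^sup>+x. h x \<partial>lborel)\<^sup>2"
proof (rule nn_integral_le_if_truncations_le)
  fix n :: nat
  let ?f = "\<lambda>x. min (f x) (of_nat n)"
  have "(\<integral>\<^sup>+x. g x \<partial>lborel) * (\<integral>\<^sup>+x. ?f x \<partial>lborel) \<le> (\<integral>\<^sup>+x. h x \<partial>lborel)\<^sup>2"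
  proof (rule nn_integral_le_if_truncations_le)
    fix k :: nat
    let ?g = "\<lambda>x. min (g x) (of_nat k)"
    have "(\<integral>\<^sup>+x. ?f x \<partial>lborel) * (\<integral>\<^sup>+x. ?g x \<partial>lborel) \<le> (\<integral>\<^sup>+x. h x \<partial>lborel)\<^sup>2"
    proof (rule prekopa_leindler_line_bounded)
      have "(SUP x. ?f x) \<le> of_nat n" "(SUP x. ?g x) \<le> of_nat k" by (auto intro: SUP_least)
      then show "(SUP x. ?f x) < \<infinity>" "(SUP x. ?g x) < \<infinity>"
        by (auto intro: le_less_trans simp: of_nat_less_top)
      show "?f x * ?g y \<le> (h ((x + y) / 2))\<^sup>2" for x y
        by (rule order_trans[OF _ fgh]) (intro mult_mono, auto)
    qed measurable
    then show "(\<integral>\<^sup>+x. ?g x \<partial>lborel) * (\<integral>\<^sup>+x. ?f x \<partial>lborel) \<le> (\<integral>\<^sup>+x. h x \<partial>lborel)\<^sup>2"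
      by (simp add: mult.commute)
  qed measurable
  then show "(\<integral>\<^sup>+x. ?f x \<partial>lborel) * (\<integral>\<^sup>+x. g x \<partial>lborel) \<le> (\<integral>\<^sup>+x. h x \<partial>lborel)\<^sup>2"
    by (simp add: mult.commute)
qed measurable

text \<open>
  Tensorization: for fixed values of one coordinate the induction hypothesis applies to the remaining
  coordinates, and the resulting partial integrals satisfy the hypothesis of the one-dimensional inequality.
\<close>
lemma prekopa_leindler_PiM:
  fixes f g h :: "('i \<Rightarrow> real) \<Rightarrow> ennreal"
  assumes "finite I"
    and "f \<in> borel_measurable (\<Pi>\<^sub>M i\<in>I. lborel)" "g \<in> borel_measurable (\<Pi>\<^sub>M i\<in>I. lborel)"
      "h \<in> borel_measurable (\<Pi>\<^sub>M i\<in>I. lborel)"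
    and "\<And>x y. x \<in> extensional I \<Longrightarrow> y \<in> extensional I \<Longrightarrow> f x * g y \<le> (h (\<lambda>i\<in>I. (x i + y i) / 2))\<^sup>2"
  shows "(\<integral>\<^sup>+x. f x \<partial>(\<Pi>\<^sub>M i\<in>I. lborel)) * (\<integral>\<^sup>+x. g x \<partial>(\<Pi>\<^sub>M i\<in>I. lborel))
    \<le> (\<integral>\<^sup>+x. h x \<partial>(\<Pi>\<^sub>M i\<in>I. lborel))\<^sup>2"
  using assms
proof (induction I arbitrary: f g h rule: finite_induct)
  case empty
  interpret product_sigma_finite "\<lambda>_. lborel :: real measure" by standard
  show ?case using empty.prems(4)[of "\<lambda>_. undefined" "\<lambda>_. undefined"]
    by (simp add: PiM_empty nn_integral_count_space_finite restrict_def)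
next
  case (insert i I)
  interpret product_sigma_finite "\<lambda>_. lborel :: real measure" by standard
  note [measurable] = insert.prems(1-3)
  have split: "(\<integral>\<^sup>+x. k x \<partial>(\<Pi>\<^sub>M i\<in>insert i I. lborel)) =
      (\<integral>\<^sup>+s. (\<integral>\<^sup>+x. k (x(i := s)) \<partial>(\<Pi>\<^sub>M i\<in>I. lborel)) \<partial>lborel)"
    if "k \<in> borel_measurable (\<Pi>\<^sub>M i\<in>insert i I. lborel)" for k :: "('i \<Rightarrow> real) \<Rightarrow> ennreal"
    using insert.hyps that by (intro product_nn_integral_insert_rev) auto
  interpret I: finite_product_sigma_finite "\<lambda>_. lborel :: real measure" I
    by standard (rule insert.hyps)
  have meas: "(\<lambda>s. \<integral>\<^sup>+x. k (x(i := s)) \<partial>(\<Pi>\<^sub>M i\<in>I. lborel)) \<in> borel_measurable borel"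
    if [measurable]: "k \<in> borel_measurable (\<Pi>\<^sub>M i\<in>insert i I. lborel)" for k :: "('i \<Rightarrow> real) \<Rightarrow> ennreal"
    by measurable
  show ?case
    unfolding split[OF insert.prems(1)] split[OF insert.prems(2)] split[OF insert.prems(3)]
  proof (rule prekopa_leindler_line)
    fix s t :: real
    show "(\<integral>\<^sup>+x. f (x(i := s)) \<partial>(\<Pi>\<^sub>M i\<in>I. lborel)) * (\<integral>\<^sup>+x. g (x(i := t)) \<partial>(\<Pi>\<^sub>M i\<in>I. lborel))
        \<le> (\<integral>\<^sup>+x. h (x(i := (s + t) / 2)) \<partial>(\<Pi>\<^sub>M i\<in>I. lborel))\<^sup>2"
    proof (rule insert.IH)
      fix x y :: "'i \<Rightarrow> real" assume xy: "x \<in> extensional I" "y \<in> extensional I"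
      have "f (x(i := s)) * g (y(i := t)) \<le> (h (\<lambda>j\<in>insert i I. ((x(i := s)) j + (y(i := t)) j) / 2))\<^sup>2"
        using xy by (intro insert.prems(4)) (auto simp: extensional_def)
      also have "(\<lambda>j\<in>insert i I. ((x(i := s)) j + (y(i := t)) j) / 2)
          = (\<lambda>j\<in>I. (x j + y j) / 2)(i := (s + t) / 2)"
        using insert.hyps by (auto simp: fun_eq_iff)
      finally show "f (x(i := s)) * g (y(i := t)) \<le> (h ((\<lambda>j\<in>I. (x j + y j) / 2)(i := (s + t) / 2)))\<^sup>2" .
    qed measurable
  qed (use meas insert.prems in auto)
qed

theorem prekopa_leindler:
  fixes f g h :: "'a::euclidean_space \<Rightarrow> ennreal"
  assumes [measurable]: "f \<in> borel_measurable borel" "g \<in> borel_measurable borel" "h \<in> borel_measurable borel"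
    and fgh: "\<And>x y. f x * g y \<le> (h ((x + y) /\<^sub>R 2))\<^sup>2"
  shows "(\<integral>\<^sup>+x. f x \<partial>lborel) * (\<integral>\<^sup>+x. g x \<partial>lborel) \<le> (\<integral>\<^sup>+x. h x \<partial>lborel)\<^sup>2"
proof -
  let ?p = "\<lambda>c::'a \<Rightarrow> real. \<Sum>b\<in>Basis. c b *\<^sub>R b"
  have int: "(\<integral>\<^sup>+x. k x \<partial>lborel) = (\<integral>\<^sup>+c. k (?p c) \<partial>(\<Pi>\<^sub>M b\<in>Basis. lborel))"
    if [measurable]: "k \<in> borel_measurable borel" for k :: "'a \<Rightarrow> ennreal"
    by (subst lborel_eq) (rule nn_integral_distr; measurable)
  have mid: "?p (\<lambda>b\<in>Basis. (c b + d b) / 2) = (?p c + ?p d) /\<^sub>R 2" for c d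
    by (simp add: scaleR_sum_right sum.distrib[symmetric] algebra_simps add_divide_distrib)
  show ?thesis
    unfolding int[OF assms(1)] int[OF assms(2)] int[OF assms(3)]
  proof (rule prekopa_leindler_PiM)
    show "f (?p x) * g (?p y) \<le> (h (?p (\<lambda>i\<in>Basis. (x i + y i) / 2)))\<^sup>2" for x y
      unfolding mid by (rule fgh)
  qed auto
qed

section \<open>Curvature of soft Legendre transforms\<close>

text \<open>
  The Prekopa-Leindler inequality is applied to the two integrands on the left. In it the points \<open>y + u\<close> and
  \<open>y - u\<close> are weighted with an additional \<open>2 * (z \<bullet> u)\<close> in the exponent, which is paid for by the strong
  convexity of \<open>q\<close>. For a quadratic \<open>q\<close> on the whole space this is an equality.
\<close>
lemma laplace_transform_le_of_convexity:
  fixes q :: "'a::euclidean_space \<Rightarrow> real"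
  assumes [measurable]: "q \<in> borel_measurable borel" "U \<in> sets borel" and "convex U" and b: "b > 0"
    and q: "\<And>y u. y + u \<in> U \<Longrightarrow> y - u \<in> U \<Longrightarrow> b * (norm u)\<^sup>2 \<le> q (y + u) + q (y - u) - 2 * q y"
  shows "(\<integral>\<^sup>+y. indicator U y * ennreal (exp (inner (x + z) y - q y)) \<partial>lborel)
      * (\<integral>\<^sup>+y. indicator U y * ennreal (exp (inner (x - z) y - q y)) \<partial>lborel)
    \<le> ennreal (exp ((norm z)\<^sup>2 / b)) * (\<integral>\<^sup>+y. indicator U y * ennreal (exp (inner x y - q y)) \<partial>lborel)\<^sup>2"
proof -
  define c where "c = (norm z)\<^sup>2 / b"
  have "(\<integral>\<^sup>+y. indicator U y * ennreal (exp (inner (x + z) y - q y)) \<partial>lborel)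
      * (\<integral>\<^sup>+y. indicator U y * ennreal (exp (inner (x - z) y - q y)) \<partial>lborel)
    \<le> (\<integral>\<^sup>+y. ennreal (exp (c / 2)) * (indicator U y * ennreal (exp (inner x y - q y))) \<partial>lborel)\<^sup>2"
  proof (rule prekopa_leindler)
    fix y1 y2 :: 'a
    define y u where "y = (y1 + y2) /\<^sub>R 2" and "u = (y1 - y2) /\<^sub>R 2"
    have y12: "y1 = y + u" "y2 = y - u"
      by (simp_all add: euclidean_eq_iff[of y1] euclidean_eq_iff[of y2] y_def u_def
          inner_add_left inner_diff_left field_simps)
    show "indicator U y1 * ennreal (exp (inner (x + z) y1 - q y1)) *
        (indicator U y2 * ennreal (exp (inner (x - z) y2 - q y2)))
      \<le> (ennreal (exp (c / 2)) * (indicator U ((y1 + y2) /\<^sub>R 2)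
          * ennreal (exp (inner x ((y1 + y2) /\<^sub>R 2) - q ((y1 + y2) /\<^sub>R 2)))))\<^sup>2"
    proof (cases "y1 \<in> U \<and> y2 \<in> U")
      case True
      then have yU: "y \<in> U"
        using convexD[OF \<open>convex U\<close>, of y1 y2 "1/2" "1/2"] by (simp add: y_def scaleR_add_right inverse_eq_divide)
      \<comment> \<open>Young's inequality absorbs the linear term into the curvature of \<open>q\<close>.\<close>
      have "0 \<le> (norm (z - b *\<^sub>R u))\<^sup>2 / b" using b by simp
      also have "\<dots> = c - 2 * inner z u + b * (norm u)\<^sup>2"
        using b unfolding c_def power2_norm_eq_inner
        by (simp add: inner_diff_left inner_diff_right inner_commute field_simps power2_eq_square)
      finally have "2 * inner z u \<le> c + b * (norm u)\<^sup>2" by simp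
      moreover have "b * (norm u)\<^sup>2 \<le> q y1 + q y2 - 2 * q y"
        using q[of y u] True unfolding y12 by simp
      moreover have "inner (x + z) y1 + inner (x - z) y2 = 2 * inner x y + 2 * inner z u"
        unfolding y12 by (simp add: inner_add_left inner_add_right inner_diff_left inner_diff_right)
      ultimately have "(inner (x + z) y1 - q y1) + (inner (x - z) y2 - q y2) \<le> c + 2 * (inner x y - q y)"
        by simp
      then have "exp (inner (x + z) y1 - q y1) * exp (inner (x - z) y2 - q y2)
          \<le> (exp (c / 2) * exp (inner x y - q y))\<^sup>2"
        by (simp flip: exp_add exp_double add: power2_eq_square)
      then show ?thesis
        using True yU unfolding y_def[symmetric]
        by (simp add: ennreal_power flip: ennreal_mult)
    qed (auto simp: indicator_def)
  qed measurable
  also have "\<dots> = ennreal (exp c) * (\<integral>\<^sup>+y. indicator U y * ennreal (exp (inner x y - q y)) \<partial>lborel)\<^sup>2"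
    by (subst nn_integral_cmult) (auto simp: power_mult_distrib ennreal_power exp_double[symmetric])
  finally show ?thesis unfolding c_def .
qed

lemma nn_integral_lborel_translate:
  fixes f :: "'a::euclidean_space \<Rightarrow> ennreal"
  assumes [measurable]: "f \<in> borel_measurable borel"
  shows "(\<integral>\<^sup>+x. f (x + s) \<partial>lborel) = (\<integral>\<^sup>+x. f x \<partial>lborel)"
proof -
  have "(\<integral>\<^sup>+x. f x \<partial>lborel) = (\<integral>\<^sup>+x. f x \<partial>distr lborel borel ((+) s))"
    by (simp add: lborel_distr_plus)
  also have "\<dots> = (\<integral>\<^sup>+x. f (x + s) \<partial>lborel)"
    by (subst nn_integral_distr) (auto simp: add.commute)
  finally show ?thesis by simp
qed

text \<open>
  The counterpart of the preceding bound, where the Cauchy-Schwarz inequality replaces the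
  Prekopa-Leindler inequality. Shifting the integration variables by \<open>s\<close> and \<open>- s\<close> before applying it
  produces the exact Gaussian factor; the choice \<open>s = z / b\<close> is the optimal one.
\<close>
lemma laplace_transform_ge_of_concavity:
  fixes q :: "'a::euclidean_space \<Rightarrow> real"
  assumes [measurable]: "q \<in> borel_measurable borel" and b: "b > 0"
    and q: "\<And>x u. q (x + u) + q (x - u) - 2 * q x \<le> b * (norm u)\<^sup>2"
  shows "ennreal (exp ((norm z)\<^sup>2 / b)) * (\<integral>\<^sup>+x. ennreal (exp (inner x y - q x)) \<partial>lborel)\<^sup>2
    \<le> (\<integral>\<^sup>+x. ennreal (exp (inner x (y + z) - q x)) \<partial>lborel)
      * (\<integral>\<^sup>+x. ennreal (exp (inner x (y - z) - q x)) \<partial>lborel)"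
proof -
  define c s where "c = (norm z)\<^sup>2 / b" and "s = z /\<^sub>R b"
  let ?A = "\<lambda>x. inner (x + s) (y + z) - q (x + s)"
  let ?B = "\<lambda>x. inner (x + - s) (y - z) - q (x + - s)"
  have sq: "(ennreal (exp (t / 2)))\<^sup>2 = ennreal (exp t)" for t
    by (subst ennreal_power) (simp_all flip: exp_double)
  have "ennreal (exp c) * (\<integral>\<^sup>+x. ennreal (exp (inner x y - q x)) \<partial>lborel)\<^sup>2
      = (\<integral>\<^sup>+x. ennreal (exp (c / 2)) * ennreal (exp (inner x y - q x)) \<partial>lborel)\<^sup>2"
    by (subst nn_integral_cmult) (auto simp: power_mult_distrib ennreal_power exp_double[symmetric])
  also have "\<dots> \<le> (\<integral>\<^sup>+x. ennreal (exp (?A x / 2)) * ennreal (exp (?B x / 2)) \<partial>lborel)\<^sup>2"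
  proof (intro power_mono nn_integral_mono)
    fix x
    have "inner (x + s) (y + z) + inner (x + - s) (y - z) = 2 * inner x y + 2 * inner s z"
      by (simp add: inner_add_left inner_add_right inner_diff_left inner_diff_right)
    moreover have "q (x + s) + q (x + - s) \<le> 2 * q x + b * (norm s)\<^sup>2"
      using q[of x s] by simp
    moreover have "b * (norm s)\<^sup>2 = c" "inner s z = c"
      using b by (simp_all add: s_def c_def power_mult_distrib power_divide power2_eq_square divide_inverse
          flip: power2_norm_eq_inner)
    ultimately have "c + 2 * (inner x y - q x) \<le> ?A x + ?B x" by simp
    moreover have "c / 2 + t \<le> r / 2 + r' / 2" if "c + 2 * t \<le> r + r'" for t r r' :: real
      using that by simp
    ultimately have "c / 2 + (inner x y - q x) \<le> ?A x / 2 + ?B x / 2" by blast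
    then have "exp (c / 2) * exp (inner x y - q x) \<le> exp (?A x / 2) * exp (?B x / 2)"
      by (simp flip: exp_add)
    then show "ennreal (exp (c / 2)) * ennreal (exp (inner x y - q x))
        \<le> ennreal (exp (?A x / 2)) * ennreal (exp (?B x / 2))"
      by (simp flip: ennreal_mult)
  qed auto
  also have "\<dots> \<le> (\<integral>\<^sup>+x. (ennreal (exp (?A x / 2)))\<^sup>2 \<partial>lborel) * (\<integral>\<^sup>+x. (ennreal (exp (?B x / 2)))\<^sup>2 \<partial>lborel)"
    by (rule Cauchy_Schwarz_nn_integral) measurable
  also have "\<dots> = (\<integral>\<^sup>+x. ennreal (exp (?A x)) \<partial>lborel) * (\<integral>\<^sup>+x. ennreal (exp (?B x)) \<partial>lborel)"
    by (simp only: sq)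
  also have "\<dots> = (\<integral>\<^sup>+x. ennreal (exp (inner x (y + z) - q x)) \<partial>lborel)
      * (\<integral>\<^sup>+x. ennreal (exp (inner x (y - z) - q x)) \<partial>lborel)"
    using nn_integral_lborel_translate[of "\<lambda>x. ennreal (exp (inner x (y + z) - q x))" s]
      nn_integral_lborel_translate[of "\<lambda>x. ennreal (exp (inner x (y - z) - q x))" "- s"] by simp
  finally show ?thesis unfolding c_def .
qed

text \<open>
  The Legendre transform \<open>sup\<^sub>y (x \<bullet> y - f y)\<close> with the supremum replaced by a soft maximum at temperature
  \<open>e\<close> with respect to \<open>M\<close>.
\<close>
definition soft_conjugate :: "real \<Rightarrow> 'a::euclidean_space measure \<Rightarrow> ('a \<Rightarrow> real) \<Rightarrow> 'a \<Rightarrow> real"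
  where "soft_conjugate e M f x = e * ln (\<integral>y. exp ((inner x y - f y) / e) \<partial>M)"

lemma (in prob_space) expectation_exp_pos:
  fixes g :: "'a \<Rightarrow> real"
  assumes "integrable M (\<lambda>x. exp (g x))"
  shows "0 < (\<integral>x. exp (g x) \<partial>M)"
  by (rule expectation_greater[OF assms]) simp

lemma (in prob_space) exp_expectation_le:
  fixes g :: "'a \<Rightarrow> real"
  assumes "integrable M g" "integrable M (\<lambda>x. exp (g x))"
  shows "exp (\<integral>x. g x \<partial>M) \<le> (\<integral>x. exp (g x) \<partial>M)"
proof -
  define c where "c = (\<integral>x. g x \<partial>M)"
  have "exp c * (1 + (g x - c)) \<le> exp (g x)" for x
    using mult_left_mono[OF exp_ge_add_one_self[of "g x - c"], of "exp c"] by (simp flip: exp_add)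
  then have "(\<integral>x. exp c * (1 + (g x - c)) \<partial>M) \<le> (\<integral>x. exp (g x) \<partial>M)"
    using assms by (intro integral_mono) auto
  also have "(\<integral>x. exp c * (1 + (g x - c)) \<partial>M) = exp c"
    using assms by (simp add: c_def prob_space)
  finally show ?thesis by (simp add: c_def)
qed

lemma soft_conjugate_normalizes:
  assumes "prob_space M" and e: "e > 0"
    and int: "integrable M (\<lambda>y. exp ((inner x y - f y) / e))"
  shows "exp (soft_conjugate e M f x / e) = (\<integral>y. exp ((inner x y - f y) / e) \<partial>M)"
  using prob_space.expectation_exp_pos[OF assms(1) int] e by (simp add: soft_conjugate_def)

lemma soft_conjugate_ge:
  assumes "prob_space M" and e: "e > 0"
    and int: "integrable M (\<lambda>y. exp ((inner x y - f y) / e))"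
    and f: "integrable M f" "integrable M (\<lambda>y. y)"
  shows "inner x (\<integral>y. y \<partial>M) - (\<integral>y. f y \<partial>M) \<le> soft_conjugate e M f x"
proof -
  interpret prob_space M by fact
  have "exp ((inner x (\<integral>y. y \<partial>M) - (\<integral>y. f y \<partial>M)) / e) = exp (\<integral>y. (inner x y - f y) / e \<partial>M)"
    using f by simp
  also have "\<dots> \<le> (\<integral>y. exp ((inner x y - f y) / e) \<partial>M)"
    using f by (intro exp_expectation_le int) auto
  also have "\<dots> = exp (soft_conjugate e M f x / e)"
    using soft_conjugate_normalizes[OF assms(1-3)] by simp
  finally show ?thesis using e by (simp add: divide_le_cancel)
qed

lemma measurable_soft_conjugate [measurable]:
  fixes M :: "'a::euclidean_space measure"
  assumes "prob_space M" "sets M = sets borel" and [measurable]: "f \<in> borel_measurable borel"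
  shows "soft_conjugate e M f \<in> borel_measurable borel"
proof -
  interpret prob_space M by fact
  have [measurable_cong]: "sets M = sets borel" by fact
  show ?thesis unfolding soft_conjugate_def[abs_def] by measurable
qed

lemma measurable_soft_conjugate_kernel [measurable]:
  fixes f g :: "'a::euclidean_space \<Rightarrow> real"
  assumes [measurable]: "f \<in> borel_measurable borel" "g \<in> borel_measurable borel"
  shows "(\<lambda>(x, y). exp ((inner x y - f x - g y) / e)) \<in> borel_measurable (borel \<Otimes>\<^sub>M borel)"
  by measurable

text \<open>
  The reference measure contributes curvature 1 and the potential \<open>a / e\<close>, so \<open>exp (- q)\<close> has curvature
  \<open>a / e + 1\<close>; multiplication by \<open>e\<close> and the rescaling of the argument by \<open>1 / e\<close> turn the resulting bound
  \<open>1 / (a / e + 1)\<close> into \<open>1 / (a + e)\<close>.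
\<close>
lemma soft_conjugate_second_difference_le:
  fixes w f :: "'a::euclidean_space \<Rightarrow> real"
  assumes M: "prob_space M" "M = density lborel (\<lambda>y. indicator U y * ennreal (exp (- w y)))"
    and [measurable]: "w \<in> borel_measurable borel" "f \<in> borel_measurable borel" "U \<in> sets borel"
    and "convex U" and e: "e > 0" and a: "a \<ge> 0"
    and w: "\<And>y u. y + u \<in> U \<Longrightarrow> y - u \<in> U \<Longrightarrow> (norm u)\<^sup>2 \<le> w (y + u) + w (y - u) - 2 * w y"
    and f: "\<And>y u. y + u \<in> U \<Longrightarrow> y - u \<in> U \<Longrightarrow> a * (norm u)\<^sup>2 \<le> f (y + u) + f (y - u) - 2 * f y"
    and int: "\<And>x. integrable M (\<lambda>y. exp ((inner x y - f y) / e))"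
  shows "soft_conjugate e M f (x + z) + soft_conjugate e M f (x - z) - 2 * soft_conjugate e M f x
    \<le> (norm z)\<^sup>2 / (a + e)"
proof -
  define q where "q y = f y / e + w y" for y
  define b where "b = a / e + 1"
  have [measurable]: "q \<in> borel_measurable borel" unfolding q_def by measurable
  define I where "I x = (\<integral>y. exp ((inner x y - f y) / e) \<partial>M)" for x
  have pos: "0 < I x" for x
    unfolding I_def using int[of x] by (rule prob_space.expectation_exp_pos[OF M(1)])
  have nn: "ennreal (I x) = (\<integral>\<^sup>+y. indicator U y * ennreal (exp (inner (x /\<^sub>R e) y - q y)) \<partial>lborel)" for x
  proof -
    have "ennreal (I x) = (\<integral>\<^sup>+y. ennreal (exp ((inner x y - f y) / e)) \<partial>M)"
      unfolding I_def using int by (intro nn_integral_eq_integral[symmetric]) auto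
    also have "\<dots> = (\<integral>\<^sup>+y. indicator U y * ennreal (exp (inner (x /\<^sub>R e) y - q y)) \<partial>lborel)"
      unfolding M(2) using e
      by (subst nn_integral_density)
        (auto simp: q_def mult.assoc field_simps simp flip: ennreal_mult exp_add intro!: nn_integral_cong)
    finally show ?thesis .
  qed
  have "ennreal (I (x + z)) * ennreal (I (x - z)) \<le> ennreal (exp ((norm (z /\<^sub>R e))\<^sup>2 / b)) * (ennreal (I x))\<^sup>2"
    unfolding nn scaleR_add_right scaleR_diff_right
  proof (rule laplace_transform_le_of_convexity)
    show "b > 0" using a e by (simp add: b_def add_nonneg_pos)
    fix y u assume yu: "y + u \<in> U" "y - u \<in> U"
    have "a * (norm u)\<^sup>2 / e + (norm u)\<^sup>2 \<le> (f (y + u) + f (y - u) - 2 * f y) / e + (w (y + u) + w (y - u) - 2 * w y)"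
      using e by (intro add_mono divide_right_mono f w yu) auto
    also have "a * (norm u)\<^sup>2 / e + (norm u)\<^sup>2 = b * (norm u)\<^sup>2"
      by (simp add: b_def distrib_right)
    finally show "b * (norm u)\<^sup>2 \<le> q (y + u) + q (y - u) - 2 * q y"
      by (simp add: q_def add_divide_distrib diff_divide_distrib)
  qed (use \<open>convex U\<close> in auto)
  then have "I (x + z) * I (x - z) \<le> exp ((norm (z /\<^sub>R e))\<^sup>2 / b) * (I x)\<^sup>2"
    using pos by (simp add: ennreal_power less_imp_le flip: ennreal_mult)
  then have "ln (I (x + z) * I (x - z)) \<le> ln (exp ((norm (z /\<^sub>R e))\<^sup>2 / b) * (I x)\<^sup>2)"
    using pos by (subst ln_le_cancel_iff) (auto intro!: mult_pos_pos zero_less_power)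
  then have "ln (I (x + z)) + ln (I (x - z)) - 2 * ln (I x) \<le> (norm (z /\<^sub>R e))\<^sup>2 / b"
    using pos[of x] pos[of "x + z"] pos[of "x - z"] by (simp add: ln_mult ln_realpow)
  then have "e * (ln (I (x + z)) + ln (I (x - z)) - 2 * ln (I x)) \<le> e * ((norm (z /\<^sub>R e))\<^sup>2 / b)"
    using e by (intro mult_left_mono) auto
  also have "e * ((norm (z /\<^sub>R e))\<^sup>2 / b) = (norm z)\<^sup>2 / (a + e)"
  proof -
    have "e * ((norm (z /\<^sub>R e))\<^sup>2 / b) = (norm z)\<^sup>2 / (e * b)"
      using e by (simp add: power_mult_distrib power2_eq_square field_simps)
    also have "e * b = a + e" using e by (simp add: b_def field_simps)
    finally show ?thesis .
  qed
  finally show ?thesis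
    by (simp add: soft_conjugate_def I_def algebra_simps)
qed

lemma soft_conjugate_second_difference_ge:
  fixes m f :: "'a::euclidean_space \<Rightarrow> real"
  assumes M: "prob_space M" "M = density lborel (\<lambda>x. ennreal (exp (- m x)))"
    and [measurable]: "m \<in> borel_measurable borel" "f \<in> borel_measurable borel"
    and e: "e > 0" and c: "c \<ge> 0"
    and m: "\<And>x u. m (x + u) + m (x - u) - 2 * m x \<le> (norm u)\<^sup>2"
    and f: "\<And>x u. f (x + u) + f (x - u) - 2 * f x \<le> c * (norm u)\<^sup>2"
    and int: "\<And>t. t \<in> {y + z, y - z, y} \<Longrightarrow> integrable M (\<lambda>x. exp ((inner t x - f x) / e))"
  shows "(norm z)\<^sup>2 / (c + e)
    \<le> soft_conjugate e M f (y + z) + soft_conjugate e M f (y - z) - 2 * soft_conjugate e M f y"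
proof -
  define q where "q y = f y / e + m y" for y
  define b where "b = c / e + 1"
  have [measurable]: "q \<in> borel_measurable borel" unfolding q_def by measurable
  define I where "I t = (\<integral>x. exp ((inner t x - f x) / e) \<partial>M)" for t
  have pos: "0 < I t" if "t \<in> {y + z, y - z, y}" for t
    unfolding I_def using int[OF that] by (rule prob_space.expectation_exp_pos[OF M(1)])
  have nn: "ennreal (I t) = (\<integral>\<^sup>+x. ennreal (exp (inner x (t /\<^sub>R e) - q x)) \<partial>lborel)"
    if "t \<in> {y + z, y - z, y}" for t
  proof -
    have "ennreal (I t) = (\<integral>\<^sup>+x. ennreal (exp ((inner t x - f x) / e)) \<partial>M)"
      unfolding I_def using int[OF that] by (intro nn_integral_eq_integral[symmetric]) auto
    also have "\<dots> = (\<integral>\<^sup>+x. ennreal (exp (inner x (t /\<^sub>R e) - q x)) \<partial>lborel)"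
      unfolding M(2) using e
      by (subst nn_integral_density)
        (auto simp: q_def field_simps inner_commute simp flip: ennreal_mult exp_add intro!: nn_integral_cong)
    finally show ?thesis .
  qed
  have "ennreal (exp ((norm (z /\<^sub>R e))\<^sup>2 / b)) * (ennreal (I y))\<^sup>2 \<le> ennreal (I (y + z)) * ennreal (I (y - z))"
    unfolding nn[OF insertI1] nn[OF insertI2[OF insertI1]] nn[OF insertI2[OF insertI2[OF singletonI]]]
      scaleR_add_right scaleR_diff_right
  proof (rule laplace_transform_ge_of_concavity)
    show "b > 0" using c e by (simp add: b_def add_nonneg_pos)
    fix x u
    have "(f (x + u) + f (x - u) - 2 * f x) / e + (m (x + u) + m (x - u) - 2 * m x) \<le> c * (norm u)\<^sup>2 / e + (norm u)\<^sup>2"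
      using e by (intro add_mono divide_right_mono f m) auto
    also have "c * (norm u)\<^sup>2 / e + (norm u)\<^sup>2 = b * (norm u)\<^sup>2"
      by (simp add: b_def distrib_right)
    finally show "q (x + u) + q (x - u) - 2 * q x \<le> b * (norm u)\<^sup>2"
      by (simp add: q_def add_divide_distrib diff_divide_distrib)
  qed auto
  then have "exp ((norm (z /\<^sub>R e))\<^sup>2 / b) * (I y)\<^sup>2 \<le> I (y + z) * I (y - z)"
    using pos by (simp add: ennreal_power less_imp_le flip: ennreal_mult)
  then have "ln (exp ((norm (z /\<^sub>R e))\<^sup>2 / b) * (I y)\<^sup>2) \<le> ln (I (y + z) * I (y - z))"
    using pos by (subst ln_le_cancel_iff) (auto intro!: mult_pos_pos zero_less_power)
  then have "(norm (z /\<^sub>R e))\<^sup>2 / b \<le> ln (I (y + z)) + ln (I (y - z)) - 2 * ln (I y)"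
    using pos[of y] pos[of "y + z"] pos[of "y - z"] by (simp add: ln_mult ln_realpow)
  then have "e * ((norm (z /\<^sub>R e))\<^sup>2 / b) \<le> e * (ln (I (y + z)) + ln (I (y - z)) - 2 * ln (I y))"
    using e by (intro mult_left_mono) auto
  also have "e * ((norm (z /\<^sub>R e))\<^sup>2 / b) = (norm z)\<^sup>2 / (c + e)"
  proof -
    have "e * ((norm (z /\<^sub>R e))\<^sup>2 / b) = (norm z)\<^sup>2 / (e * b)"
      using e by (simp add: power_mult_distrib power2_eq_square field_simps)
    also have "e * b = c + e" using e by (simp add: b_def field_simps)
    finally show ?thesis .
  qed
  finally show ?thesis
    by (simp add: soft_conjugate_def I_def algebra_simps)
qed

section \<open>Nearly optimal entropic couplings\<close>

lemma open_notin_null_sets_lborel: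
  fixes S :: "'a::euclidean_space set"
  assumes "open S" "S \<noteq> {}"
  shows "S \<notin> null_sets lborel"
proof
  assume null: "S \<in> null_sets lborel"
  obtain x where "x \<in> S" using assms by blast
  then obtain r where r: "r > 0" "ball x r \<subseteq> S" using assms openE by blast
  have "ball x r \<in> null_sets lborel" by (rule null_sets_subset[OF null _ r(2)]) simp
  then show False using content_ball_pos[OF r(1), of x] by (simp add: measure_def null_setsD1)
qed

lemma square_norm_second_difference:
  fixes x u :: "'a::real_inner"
  shows "(norm (x + u))\<^sup>2 / 2 + (norm (x - u))\<^sup>2 / 2 - 2 * ((norm x)\<^sup>2 / 2) = (norm u)\<^sup>2"
proof -
  have "(norm (x + u))\<^sup>2 = (norm x)\<^sup>2 + 2 * inner x u + (norm u)\<^sup>2"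
    "(norm (x - u))\<^sup>2 = (norm x)\<^sup>2 - 2 * inner x u + (norm u)\<^sup>2"
    unfolding power2_norm_eq_inner
    by (simp_all add: inner_add_left inner_add_right inner_diff_left inner_diff_right inner_commute[of u x])
  then show ?thesis by linarith
qed

lemma convex_midpoint:
  fixes y u :: "'a::real_vector"
  assumes "convex S" "y + u \<in> S" "y - u \<in> S"
  shows "y \<in> S"
proof -
  have "(1/2) *\<^sub>R (y + u) + (1/2) *\<^sub>R (y - u) = y"
    by (simp add: scaleR_add_right scaleR_diff_right flip: scaleR_add_left)
  then show ?thesis using convexD[OF assms, of "1/2" "1/2"] by simp
qed

lemma lipschitz_function_regularity:
  fixes F :: "'a::euclidean_space \<Rightarrow> real"
  assumes L: "\<And>x y. \<bar>F x - F y\<bar> \<le> L * norm (x - y)"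
  shows "0 \<le> L" and "continuous_on UNIV F"
proof -
  obtain b :: 'a where "b \<in> Basis" using nonempty_Basis by blast
  then show "0 \<le> L" using L[of b 0] by (smt (verit) diff_zero norm_Basis mult_cancel_left2 abs_ge_zero)
  with L have "L-lipschitz_on UNIV F" by (intro lipschitz_onI) (auto simp: dist_norm)
  then show "continuous_on UNIV F" by (rule lipschitz_on_continuous_on)
qed

lemma AE_lborel_affine:
  fixes t :: "'a::euclidean_space"
  assumes "AE y in lborel. P y" and [measurable]: "{y. P y} \<in> sets borel" and c: "c \<noteq> 0"
  shows "AE z in lborel. P (t + c *\<^sub>R z)"
proof -
  have "AE y in density (distr lborel borel (\<lambda>x. t + c *\<^sub>R x)) (\<lambda>_. ennreal (\<bar>c\<bar>^DIM('a))). P y"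
    by (rule subst[where P = "\<lambda>M. AE y in M. P y", OF lborel_affine[OF c, of t] assms(1)])
  then have "AE y in distr lborel borel (\<lambda>x. t + c *\<^sub>R x). P y"
    using c by (subst (asm) AE_density) (auto simp: ennreal_zero_less_mult_iff)
  then show ?thesis by (subst (asm) AE_distr_iff) auto
qed

text \<open>
  The exceptional null set and its reflection at \<open>y\<close> cannot cover a neighbourhood of \<open>y\<close>. This is how
  almost sure finiteness of a midpoint convex function becomes finiteness at every interior point.
\<close>
lemma ex_symmetric_pair_of_AE:
  fixes y :: "'a::euclidean_space"
  assumes ae: "AE y in lborel. y \<in> U \<longrightarrow> P y" and [measurable]: "{y. P y} \<in> sets borel"
    and U: "open U" "y \<in> U"
  shows "\<exists>z. y + z \<in> U \<and> y - z \<in> U \<and> P (y + z) \<and> P (y - z)"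
proof (rule ccontr)
  assume no: "\<not> ?thesis"
  have [measurable]: "U \<in> sets borel" using U by simp
  have [measurable]: "Measurable.pred borel P" using assms(2) by (simp add: pred_def)
  have m: "{y. y \<in> U \<longrightarrow> P y} \<in> sets borel"
    by measurable
  have "AE z in lborel. (y + 1 *\<^sub>R z \<in> U \<longrightarrow> P (y + 1 *\<^sub>R z)) \<and> (y + (-1) *\<^sub>R z \<in> U \<longrightarrow> P (y + (-1) *\<^sub>R z))"
    by (intro AE_conjI AE_lborel_affine[OF ae m]) auto
  then have ae0: "AE z in lborel. \<not> (y + z \<in> U \<and> y - z \<in> U)"
    by (rule eventually_mono) (use no in auto)
  obtain r where r: "r > 0" "ball y r \<subseteq> U" using U openE by blast
  have "AE z in lborel. z \<notin> ball (0::'a) r"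
  proof (rule eventually_mono[OF ae0], rule notI)
    fix z :: 'a assume *: "\<not> (y + z \<in> U \<and> y - z \<in> U)" "z \<in> ball 0 r"
    then have "y + z \<in> ball y r" "y - z \<in> ball y r" by (auto simp: dist_norm)
    with r * show False by blast
  qed
  then have "ball (0::'a) r \<in> null_sets lborel"
    by (subst AE_iff_null_sets) auto
  then show False
    using open_notin_null_sets_lborel[of "ball (0::'a) r"] r(1) by simp
qed

text \<open>
  The source \<open>\<mu>\<close> is less log-concave than the standard Gaussian and the target \<open>\<nu>\<close> is more log-concave,
  with both properties expressed by second differences of the exponents. The temperature \<open>e\<close> of the entropic
  regularization is fixed here and tends to 0 only at the end.
\<close>
locale contraction_pair =
  fixes \<mu> \<nu> :: "'a::euclidean_space measure" and m w :: "'a \<Rightarrow> real" and U :: "'a set" and R e :: real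
  assumes prob_mu: "prob_space \<mu>" and prob_nu: "prob_space \<nu>"
    and mu: "\<mu> = density lborel (\<lambda>x. ennreal (exp (- m x)))"
    and nu: "\<nu> = density lborel (\<lambda>y. indicator U y * ennreal (exp (- w y)))"
    and m_measurable [measurable]: "m \<in> borel_measurable borel"
    and w_measurable [measurable]: "w \<in> borel_measurable borel"
    and U: "open U" "convex U"
    and R: "\<And>y. y \<in> U \<Longrightarrow> norm y \<le> R"
    and m2: "\<And>x u. m (x + u) + m (x - u) - 2 * m x \<le> (norm u)\<^sup>2"
    and w2: "\<And>y u. y + u \<in> U \<Longrightarrow> y - u \<in> U \<Longrightarrow> (norm u)\<^sup>2 \<le> w (y + u) + w (y - u) - 2 * w y"
    and moment: "integrable \<mu> (\<lambda>x. x)"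
    and e: "e > 0"
begin

sublocale mu: prob_space \<mu> by (rule prob_mu)
sublocale nu: prob_space \<nu> by (rule prob_nu)
sublocale pair_sigma_finite \<mu> \<nu> by standard

lemma sets_mu [measurable_cong, simp]: "sets \<mu> = sets borel" by (simp add: mu)
lemma sets_nu [measurable_cong, simp]: "sets \<nu> = sets borel" by (simp add: nu)
lemma space_mu [simp]: "space \<mu> = UNIV" by (simp add: mu)
lemma space_nu [simp]: "space \<nu> = UNIV" by (simp add: nu)
lemma U_measurable [measurable]: "U \<in> sets borel" using U by simp

lemma AE_nu_iff: "(AE y in \<nu>. P y) \<longleftrightarrow> (AE y in lborel. y \<in> U \<longrightarrow> P y)"
  unfolding nu by (subst AE_density) (auto simp: indicator_def zero_less_mult_iff)

lemma AE_nu: "AE y in \<nu>. y \<in> U"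
  by (simp add: AE_nu_iff)

lemma R_nonneg: "0 \<le> R"
proof (rule ccontr)
  assume "\<not> 0 \<le> R"
  then have "U = {}" using R by (metis all_not_in_conv norm_ge_zero order_trans)
  then show False using nu.AE_False AE_nu by simp
qed

lemma integrable_nu_id: "integrable \<nu> (\<lambda>y. y)"
  using AE_nu by (intro nu.integrable_const_bound[where B=R]) (auto elim!: eventually_mono intro: R)

text \<open>
  The class in which the dual problem is minimized. The curvature \<open>1 / (1 + e)\<close> is chosen so that the class
  is invariant under Sinkhorn steps: from curvature at least \<open>1 / (1 + e)\<close> of \<open>\<psi>\<close> the forward conjugate
  has curvature at most \<open>1 / (1 / (1 + e) + e) \<le> 1\<close>, and from curvature at most 1 of the latter the
  backward conjugate has curvature at least \<open>1 / (1 + e)\<close> again. The lower bound keeps the forward conjugate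
  finite, and integrability gives the dual objective a meaning.
\<close>
definition admissible :: "('a \<Rightarrow> real) \<Rightarrow> bool" where
  "admissible \<psi> \<longleftrightarrow> \<psi> \<in> borel_measurable borel \<and> (\<exists>C. \<forall>y\<in>U. C \<le> \<psi> y) \<and> integrable \<nu> \<psi> \<and>
    (\<forall>y u. y + u \<in> U \<longrightarrow> y - u \<in> U \<longrightarrow> (norm u)\<^sup>2 / (1 + e) \<le> \<psi> (y + u) + \<psi> (y - u) - 2 * \<psi> y)"

abbreviation forward :: "('a \<Rightarrow> real) \<Rightarrow> 'a \<Rightarrow> real"
  where "forward \<psi> \<equiv> soft_conjugate e \<nu> \<psi>"

abbreviation sinkhorn :: "('a \<Rightarrow> real) \<Rightarrow> 'a \<Rightarrow> real"
  where "sinkhorn \<psi> \<equiv> soft_conjugate e \<mu> (forward \<psi>)"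

lemma admissible_measurable: "admissible \<psi> \<Longrightarrow> \<psi> \<in> borel_measurable borel"
  by (simp add: admissible_def)

lemma integrable_exp_nu:
  assumes "admissible \<psi>"
  shows "integrable \<nu> (\<lambda>y. exp ((inner x y - \<psi> y) / e))"
proof -
  have [measurable]: "\<psi> \<in> borel_measurable borel" using assms by (rule admissible_measurable)
  obtain C where C: "\<And>y. y \<in> U \<Longrightarrow> C \<le> \<psi> y" using assms by (auto simp: admissible_def)
  show ?thesis
  proof (rule nu.integrable_const_bound[where B = "exp ((norm x * R - C) / e)"])
    show "AE y in \<nu>. norm (exp ((inner x y - \<psi> y) / e)) \<le> exp ((norm x * R - C) / e)"
      using AE_nu
    proof (rule eventually_mono)
      fix y assume y: "y \<in> U"
      have "inner x y \<le> norm x * norm y" by (rule norm_cauchy_schwarz)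
      also have "\<dots> \<le> norm x * R" using R[OF y] by (intro mult_left_mono) auto
      finally show "norm (exp ((inner x y - \<psi> y) / e)) \<le> exp ((norm x * R - C) / e)"
        using C[OF y] e by (simp add: divide_right_mono)
    qed
  qed measurable
qed

lemma forward_lipschitz:
  assumes "admissible \<psi>"
  shows "forward \<psi> x - forward \<psi> x' \<le> R * norm (x - x')"
proof -
  define c where "c = R * norm (x - x')"
  have "exp (forward \<psi> x / e) = (\<integral>y. exp ((inner x y - \<psi> y) / e) \<partial>\<nu>)"
    by (rule soft_conjugate_normalizes[OF prob_nu e integrable_exp_nu[OF assms]])
  also have "\<dots> \<le> (\<integral>y. exp (c / e) * exp ((inner x' y - \<psi> y) / e) \<partial>\<nu>)"
  proof (rule integral_mono_AE)
    show "AE y in \<nu>. exp ((inner x y - \<psi> y) / e) \<le> exp (c / e) * exp ((inner x' y - \<psi> y) / e)"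
      using AE_nu
    proof (rule eventually_mono)
      fix y assume y: "y \<in> U"
      have "inner (x - x') y \<le> norm (x - x') * norm y" by (rule norm_cauchy_schwarz)
      also have "\<dots> \<le> c" using R[OF y] unfolding c_def by (subst mult.commute) (intro mult_right_mono, auto)
      finally have "(inner x y - \<psi> y) / e \<le> c / e + (inner x' y - \<psi> y) / e"
        using e by (simp add: inner_diff_left divide_right_mono flip: add_divide_distrib)
      then show "exp ((inner x y - \<psi> y) / e) \<le> exp (c / e) * exp ((inner x' y - \<psi> y) / e)"
        by (simp flip: exp_add)
    qed
  qed (auto intro!: integrable_exp_nu assms)
  also have "\<dots> = exp (c / e) * exp (forward \<psi> x' / e)"
    by (simp add: soft_conjugate_normalizes[OF prob_nu e integrable_exp_nu[OF assms]])
  finally have "forward \<psi> x / e \<le> c / e + forward \<psi> x' / e"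
    by (simp flip: exp_add)
  then show ?thesis
    using e by (simp add: c_def divide_le_cancel flip: add_divide_distrib)
qed

lemma forward_measurable [measurable]: "admissible \<psi> \<Longrightarrow> forward \<psi> \<in> borel_measurable borel"
  by (intro measurable_soft_conjugate prob_nu admissible_measurable) auto

lemma forward_integrable:
  assumes "admissible \<psi>"
  shows "integrable \<mu> (forward \<psi>)"
proof (rule Bochner_Integration.integrable_bound)
  show "integrable \<mu> (\<lambda>x. \<bar>forward \<psi> 0\<bar> + R * norm x)" using moment by auto
  show "forward \<psi> \<in> borel_measurable \<mu>" using forward_measurable[OF assms] by simp
  have "\<bar>forward \<psi> x\<bar> \<le> \<bar>forward \<psi> 0\<bar> + R * norm x" for x
    using forward_lipschitz[OF assms, of x 0] forward_lipschitz[OF assms, of 0 x] by simp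
  then show "AE x in \<mu>. norm (forward \<psi> x) \<le> norm (\<bar>forward \<psi> 0\<bar> + R * norm x)"
    using R_nonneg by (intro AE_I2) (simp add: abs_of_nonneg)
qed

lemma forward_second_difference:
  assumes "admissible \<psi>"
  shows "forward \<psi> (x + z) + forward \<psi> (x - z) - 2 * forward \<psi> x \<le> (norm z)\<^sup>2"
proof -
  have "forward \<psi> (x + z) + forward \<psi> (x - z) - 2 * forward \<psi> x \<le> (norm z)\<^sup>2 / (1 / (1 + e) + e)"
    using assms e U
    by (intro soft_conjugate_second_difference_le[OF prob_nu nu] integrable_exp_nu w2)
      (auto simp: admissible_def)
  also have "\<dots> \<le> (norm z)\<^sup>2 / 1"
  proof (rule divide_left_mono)
    have "1 \<le> (1 + e) * (1 / (1 + e) + e)" using e by (simp add: field_simps)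
    then show "1 \<le> 1 / (1 + e) + e" using e by (simp add: field_simps add_pos_pos)
  qed (use e in \<open>auto intro!: add_pos_pos\<close>)
  finally show ?thesis by simp
qed

text \<open>
  The density with respect to the product of \<open>\<mu>\<close> and \<open>\<nu>\<close> of the entropic coupling with potential \<open>\<psi>\<close>.
  Taking the forward conjugate as the other potential makes its first marginal equal to \<open>\<mu>\<close>.
\<close>
definition plan :: "('a \<Rightarrow> real) \<Rightarrow> 'a \<Rightarrow> 'a \<Rightarrow> real" where
  "plan \<psi> x y = exp ((inner x y - forward \<psi> x - \<psi> y) / e)"

lemma plan_pos: "0 < plan \<psi> x y" by (simp add: plan_def)

lemma plan_measurable [measurable]:
  assumes "admissible \<psi>"
  shows "(\<lambda>(x, y). plan \<psi> x y) \<in> borel_measurable (borel \<Otimes>\<^sub>M borel)"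
  unfolding plan_def using forward_measurable[OF assms] admissible_measurable[OF assms]
  by (intro measurable_soft_conjugate_kernel)

lemma plan_eq: "plan \<psi> x y = exp (- forward \<psi> x / e) * exp ((inner x y - \<psi> y) / e)"
  by (simp add: plan_def diff_divide_distrib flip: exp_add)

lemma plan_eq': "plan \<psi> x y = exp (- \<psi> y / e) * exp ((inner y x - forward \<psi> x) / e)"
  by (simp add: plan_def diff_divide_distrib inner_commute flip: exp_add)

lemma plan_first_marginal:
  assumes "admissible \<psi>"
  shows "integrable \<nu> (plan \<psi> x)" "(\<integral>y. plan \<psi> x y \<partial>\<nu>) = 1"
proof -
  show "integrable \<nu> (plan \<psi> x)"
    unfolding plan_eq[abs_def] by (intro integrable_mult_right integrable_exp_nu assms)
  show "(\<integral>y. plan \<psi> x y \<partial>\<nu>) = 1"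
    unfolding plan_eq integral_mult_right_zero
      soft_conjugate_normalizes[OF prob_nu e integrable_exp_nu[OF assms], symmetric]
    by (simp flip: exp_add)
qed

lemma plan_total_mass:
  assumes "admissible \<psi>"
  shows "(\<integral>\<^sup>+y. (\<integral>\<^sup>+x. ennreal (plan \<psi> x y) \<partial>\<mu>) \<partial>\<nu>) = 1"
proof -
  note [measurable] = plan_measurable[OF assms]
  have "(\<integral>\<^sup>+y. (\<integral>\<^sup>+x. ennreal (plan \<psi> x y) \<partial>\<mu>) \<partial>\<nu>) = (\<integral>\<^sup>+x. (\<integral>\<^sup>+y. ennreal (plan \<psi> x y) \<partial>\<nu>) \<partial>\<mu>)"
    by (rule Fubini') measurable
  also have "\<dots> = (\<integral>\<^sup>+x. 1 \<partial>\<mu>)"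
    using plan_first_marginal[OF assms] plan_pos
    by (intro nn_integral_cong) (simp add: nn_integral_eq_integral less_imp_le)
  also have "\<dots> = 1" using mu.emeasure_space_1 by simp
  finally show ?thesis .
qed

text \<open>
  The tails of \<open>\<mu>\<close> may be heavy, so finiteness is not obvious. As the total mass of the plan is 1, the integral is
  finite for almost every \<open>y\<close>; convexity in \<open>y\<close> then makes it finite at each point of the open set \<open>U\<close>.
\<close>
lemma integrable_exp_mu:
  assumes "admissible \<psi>" and y: "y \<in> U"
  shows "integrable \<mu> (\<lambda>x. exp ((inner y x - forward \<psi> x) / e))"
proof -
  note [measurable] = plan_measurable[OF assms(1)] forward_measurable[OF assms(1)]
  define fin where "fin y \<longleftrightarrow> (\<integral>\<^sup>+x. ennreal (exp ((inner y x - forward \<psi> x) / e)) \<partial>\<mu>) < \<infinity>" for y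
  \<comment> \<open>Finiteness of the exponential integral is equivalent to that of the second marginal of the plan.\<close>
  have "AE y in \<nu>. (\<integral>\<^sup>+x. ennreal (plan \<psi> x y) \<partial>\<mu>) \<noteq> \<infinity>"
    using plan_total_mass[OF assms(1)] by (intro nn_integral_PInf_AE) auto
  then have "AE y in \<nu>. fin y"
  proof (rule eventually_mono)
    fix y assume "(\<integral>\<^sup>+x. ennreal (plan \<psi> x y) \<partial>\<mu>) \<noteq> \<infinity>"
    then show "fin y"
      unfolding plan_eq' fin_def
      by (simp add: ennreal_mult nn_integral_cmult ennreal_mult_eq_top_iff less_top)
  qed
  then have "AE y in lborel. y \<in> U \<longrightarrow> fin y" by (simp add: AE_nu_iff)
  moreover have "{y. fin y} \<in> sets borel" unfolding fin_def by measurable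
  ultimately obtain z where z: "fin (y + z)" "fin (y - z)"
    using ex_symmetric_pair_of_AE[OF _ _ U(1) y] by blast
  have "(\<integral>\<^sup>+x. ennreal (exp ((inner y x - forward \<psi> x) / e)) \<partial>\<mu>) \<le>
      (\<integral>\<^sup>+x. ennreal (exp ((inner (y + z) x - forward \<psi> x) / e)) + ennreal (exp ((inner (y - z) x - forward \<psi> x) / e)) \<partial>\<mu>)"
  proof (rule nn_integral_mono)
    fix x
    have "inner y x \<le> max (inner (y + z) x) (inner (y - z) x)"
      by (simp add: inner_add_left inner_diff_left max_def)
    then have "exp ((inner y x - forward \<psi> x) / e) \<le> exp ((inner (y + z) x - forward \<psi> x) / e)
        \<or> exp ((inner y x - forward \<psi> x) / e) \<le> exp ((inner (y - z) x - forward \<psi> x) / e)"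
      using e by (auto simp: le_max_iff_disj divide_right_mono)
    then have "exp ((inner y x - forward \<psi> x) / e) \<le> exp ((inner (y + z) x - forward \<psi> x) / e)
        + exp ((inner (y - z) x - forward \<psi> x) / e)"
      by (meson add_increasing add_increasing2 exp_ge_zero)
    then show "ennreal (exp ((inner y x - forward \<psi> x) / e)) \<le>
      ennreal (exp ((inner (y + z) x - forward \<psi> x) / e)) + ennreal (exp ((inner (y - z) x - forward \<psi> x) / e))"
      by (simp flip: ennreal_plus)
  qed
  also have "\<dots> < \<infinity>"
    using z unfolding fin_def by (subst nn_integral_add) (auto simp: ennreal_add_less_top)
  finally show ?thesis
    by (intro integrableI_bounded) auto
qed

lemma plan_second_marginal:
  assumes "admissible \<psi>" and y: "y \<in> U"
  shows "integrable \<mu> (\<lambda>x. plan \<psi> x y)" "(\<integral>x. plan \<psi> x y \<partial>\<mu>) = exp ((sinkhorn \<psi> y - \<psi> y) / e)"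
proof -
  show "integrable \<mu> (\<lambda>x. plan \<psi> x y)"
    unfolding plan_eq' by (intro integrable_mult_right integrable_exp_mu assms)
  show "(\<integral>x. plan \<psi> x y \<partial>\<mu>) = exp ((sinkhorn \<psi> y - \<psi> y) / e)"
    unfolding plan_eq' integral_mult_right_zero
      soft_conjugate_normalizes[OF prob_mu e integrable_exp_mu[OF assms], symmetric]
    by (simp add: diff_divide_distrib flip: exp_add)
qed

lemma sinkhorn_measurable [measurable]: "admissible \<psi> \<Longrightarrow> sinkhorn \<psi> \<in> borel_measurable borel"
  by (intro measurable_soft_conjugate prob_mu forward_measurable) auto

lemma marginal_ratio:
  assumes "admissible \<psi>"
  shows "integrable \<nu> (\<lambda>y. exp ((sinkhorn \<psi> y - \<psi> y) / e))"
    and "(\<integral>y. exp ((sinkhorn \<psi> y - \<psi> y) / e) \<partial>\<nu>) = 1"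
proof -
  note [measurable] = sinkhorn_measurable[OF assms] admissible_measurable[OF assms]
  have "(\<integral>\<^sup>+y. ennreal (exp ((sinkhorn \<psi> y - \<psi> y) / e)) \<partial>\<nu>) = (\<integral>\<^sup>+y. (\<integral>\<^sup>+x. ennreal (plan \<psi> x y) \<partial>\<mu>) \<partial>\<nu>)"
  proof (rule nn_integral_cong_AE, rule eventually_mono[OF AE_nu])
    fix y assume "y \<in> U"
    then show "ennreal (exp ((sinkhorn \<psi> y - \<psi> y) / e)) = (\<integral>\<^sup>+x. ennreal (plan \<psi> x y) \<partial>\<mu>)"
      using plan_second_marginal[OF assms] plan_pos by (simp add: nn_integral_eq_integral less_imp_le)
  qed
  then have nn: "(\<integral>\<^sup>+y. ennreal (exp ((sinkhorn \<psi> y - \<psi> y) / e)) \<partial>\<nu>) = ennreal 1"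
    using plan_total_mass[OF assms] by simp
  then show int: "integrable \<nu> (\<lambda>y. exp ((sinkhorn \<psi> y - \<psi> y) / e))"
    by (intro integrableI_nn_integral_finite) auto
  show "(\<integral>y. exp ((sinkhorn \<psi> y - \<psi> y) / e) \<partial>\<nu>) = 1"
    using nn by (subst integral_eq_nn_integral) auto
qed

lemma admissible_sinkhorn:
  assumes "admissible \<psi>"
  shows "admissible (sinkhorn \<psi>)"
proof -
  note [measurable] = sinkhorn_measurable[OF assms] admissible_measurable[OF assms]
  define C where "C = - R * norm (\<integral>x. x \<partial>\<mu>) - (\<integral>x. forward \<psi> x \<partial>\<mu>)"
  have C: "C \<le> sinkhorn \<psi> y" if y: "y \<in> U" for y
  proof -
    have "- inner y (\<integral>x. x \<partial>\<mu>) \<le> norm y * norm (\<integral>x. x \<partial>\<mu>)"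
      using Cauchy_Schwarz_ineq2[of y "\<integral>x. x \<partial>\<mu>"] by linarith
    also have "\<dots> \<le> R * norm (\<integral>x. x \<partial>\<mu>)" using R[OF y] by (intro mult_right_mono) auto
    finally have "C \<le> inner y (\<integral>x. x \<partial>\<mu>) - (\<integral>x. forward \<psi> x \<partial>\<mu>)" by (simp add: C_def)
    also have "\<dots> \<le> sinkhorn \<psi> y"
      by (intro soft_conjugate_ge prob_mu e integrable_exp_mu forward_integrable assms moment y)
    finally show ?thesis .
  qed
  let ?r = "\<lambda>y. exp ((sinkhorn \<psi> y - \<psi> y) / e)"
  have int: "integrable \<nu> (sinkhorn \<psi>)"
  proof (rule Bochner_Integration.integrable_bound)
    show "integrable \<nu> (\<lambda>y. \<bar>C\<bar> + \<bar>\<psi> y\<bar> + e * ?r y)"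
      using marginal_ratio[OF assms] assms by (auto simp: admissible_def)
    show "AE y in \<nu>. norm (sinkhorn \<psi> y) \<le> norm (\<bar>C\<bar> + \<bar>\<psi> y\<bar> + e * ?r y)"
      using AE_nu
    proof (rule eventually_mono)
      fix y assume y: "y \<in> U"
      \<comment> \<open>Above, the increase over \<open>\<psi>\<close> is dominated by the density ratio, whose integral is 1.\<close>
      have "(sinkhorn \<psi> y - \<psi> y) / e \<le> ?r y"
        using exp_ge_add_one_self[of "(sinkhorn \<psi> y - \<psi> y) / e"] by linarith
      then have "sinkhorn \<psi> y - \<psi> y \<le> e * ?r y"
        using e by (simp add: pos_divide_le_eq mult.commute)
      moreover have "0 \<le> e * ?r y" using e by simp
      ultimately show "norm (sinkhorn \<psi> y) \<le> norm (\<bar>C\<bar> + \<bar>\<psi> y\<bar> + e * ?r y)"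
        using C[OF y] unfolding real_norm_def by linarith
    qed
    show "sinkhorn \<psi> \<in> borel_measurable \<nu>" using sinkhorn_measurable[OF assms] by simp
  qed
  have "(norm u)\<^sup>2 / (1 + e) \<le> sinkhorn \<psi> (y + u) + sinkhorn \<psi> (y - u) - 2 * sinkhorn \<psi> y"
    if yu: "y + u \<in> U" "y - u \<in> U" for y u
    using convex_midpoint[OF U(2) yu] yu forward_second_difference[OF assms] e forward_measurable[OF assms]
    by (intro soft_conjugate_second_difference_ge[OF prob_mu mu] m2 integrable_exp_mu assms) auto
  with C int show ?thesis unfolding admissible_def by (intro conjI) (auto intro: sinkhorn_measurable assms)
qed

lemma admissible_half_square: "admissible (\<lambda>y. (norm y)\<^sup>2 / 2)"
  unfolding admissible_def
proof (intro conjI allI impI exI[of _ 0] ballI)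
  show "integrable \<nu> (\<lambda>y. (norm y)\<^sup>2 / 2)"
    using AE_nu by (intro nu.integrable_const_bound[where B="R\<^sup>2 / 2"]) (auto elim!: eventually_mono simp: R power_mono)
  fix y u :: 'a
  note square_norm_second_difference[of y u]
  moreover have "(norm u)\<^sup>2 / (1 + e) \<le> (norm u)\<^sup>2" using e by (simp add: divide_le_eq mult_le_cancel_left1)
  ultimately show "(norm u)\<^sup>2 / (1 + e) \<le> (norm (y + u))\<^sup>2 / 2 + (norm (y - u))\<^sup>2 / 2 - 2 * ((norm y)\<^sup>2 / 2)"
    by simp
qed auto

text \<open>
  The objective of the dual of the entropic transport problem, which is to be minimized. A Sinkhorn step
  lowers it at least by \<open>e\<close> times the relative entropy of \<open>\<nu>\<close> with respect to the second marginal of the plan.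
\<close>
definition dual_value :: "('a \<Rightarrow> real) \<Rightarrow> real" where
  "dual_value \<psi> = (\<integral>x. forward \<psi> x \<partial>\<mu>) + (\<integral>y. \<psi> y \<partial>\<nu>)"

lemma dual_value_ge:
  assumes "admissible \<psi>"
  shows "inner (\<integral>x. x \<partial>\<mu>) (\<integral>y. y \<partial>\<nu>) \<le> dual_value \<psi>"
proof -
  have "inner x (\<integral>y. y \<partial>\<nu>) - (\<integral>y. \<psi> y \<partial>\<nu>) \<le> forward \<psi> x" for x
    using assms by (intro soft_conjugate_ge prob_nu e integrable_exp_nu integrable_nu_id) (auto simp: admissible_def)
  then have "(\<integral>x. inner x (\<integral>y. y \<partial>\<nu>) - (\<integral>y. \<psi> y \<partial>\<nu>) \<partial>\<mu>) \<le> (\<integral>x. forward \<psi> x \<partial>\<mu>)"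
    using moment by (intro integral_mono forward_integrable assms) auto
  then show ?thesis
    using moment mu.prob_space by (simp add: dual_value_def)
qed

text \<open>
  The function \<open>exp ((forward (sinkhorn \<psi>) x - forward \<psi> x) / e)\<close> is the density of the first marginal of
  the coupling obtained after correcting the second marginal, so it integrates to 1; the inequality
  \<open>1 + t \<le> exp t\<close> then compares the exponents.
\<close>
lemma integral_forward_decreasing:
  assumes "admissible \<psi>"
  shows "(\<integral>x. forward (sinkhorn \<psi>) x \<partial>\<mu>) \<le> (\<integral>x. forward \<psi> x \<partial>\<mu>)"
proof -
  define \<psi>' where "\<psi>' = sinkhorn \<psi>"
  have adm': "admissible \<psi>'" unfolding \<psi>'_def by (rule admissible_sinkhorn[OF assms])
  note [measurable] = admissible_measurable[OF assms] admissible_measurable[OF adm']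
    forward_measurable[OF assms] forward_measurable[OF adm']
  let ?k = "\<lambda>x y. exp ((inner x y - forward \<psi> x - \<psi>' y) / e)"
  let ?s = "\<lambda>x. exp ((forward \<psi>' x - forward \<psi> x) / e)"
  have "(\<integral>\<^sup>+x. ennreal (?s x) \<partial>\<mu>) = (\<integral>\<^sup>+x. (\<integral>\<^sup>+y. ennreal (?k x y) \<partial>\<nu>) \<partial>\<mu>)"
  proof (rule nn_integral_cong)
    fix x
    have k: "?k x y = exp (- forward \<psi> x / e) * exp ((inner x y - \<psi>' y) / e)" for y
      by (simp add: diff_divide_distrib flip: exp_add)
    have "integrable \<nu> (?k x)" unfolding k by (intro integrable_mult_right integrable_exp_nu adm')
    moreover have "(\<integral>y. ?k x y \<partial>\<nu>) = ?s x"
      unfolding k integral_mult_right_zero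
        soft_conjugate_normalizes[OF prob_nu e integrable_exp_nu[OF adm'], symmetric]
      by (simp add: diff_divide_distrib flip: exp_add)
    ultimately show "ennreal (?s x) = (\<integral>\<^sup>+y. ennreal (?k x y) \<partial>\<nu>)"
      by (simp add: nn_integral_eq_integral)
  qed
  also have "\<dots> = (\<integral>\<^sup>+y. (\<integral>\<^sup>+x. ennreal (?k x y) \<partial>\<mu>) \<partial>\<nu>)"
    by (rule Fubini'[symmetric]) measurable
  also have "\<dots> = (\<integral>\<^sup>+y. 1 \<partial>\<nu>)"
  proof (rule nn_integral_cong_AE, rule eventually_mono[OF AE_nu])
    fix y assume y: "y \<in> U"
    have k: "?k x y = exp (- \<psi>' y / e) * exp ((inner y x - forward \<psi> x) / e)" for x
      by (simp add: diff_divide_distrib inner_commute flip: exp_add)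
    have "integrable \<mu> (\<lambda>x. ?k x y)" unfolding k by (intro integrable_mult_right integrable_exp_mu assms y)
    moreover have "(\<integral>x. ?k x y \<partial>\<mu>) = 1"
      unfolding k integral_mult_right_zero
        soft_conjugate_normalizes[OF prob_mu e integrable_exp_mu[OF assms y], symmetric]
      by (simp add: \<psi>'_def flip: exp_add)
    ultimately show "(\<integral>\<^sup>+x. ennreal (?k x y) \<partial>\<mu>) = 1"
      by (simp add: nn_integral_eq_integral)
  qed
  also have "\<dots> = ennreal 1" using nu.emeasure_space_1 by simp
  finally have nn: "(\<integral>\<^sup>+x. ennreal (?s x) \<partial>\<mu>) = ennreal 1" .
  then have int: "integrable \<mu> ?s" by (intro integrableI_nn_integral_finite) auto
  have one: "(\<integral>x. ?s x \<partial>\<mu>) = 1" using nn by (subst integral_eq_nn_integral) auto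
  have "(\<integral>x. 1 + (forward \<psi>' x - forward \<psi> x) / e \<partial>\<mu>) \<le> (\<integral>x. ?s x \<partial>\<mu>)"
    using forward_integrable[OF assms] forward_integrable[OF adm'] int
    by (intro integral_mono exp_ge_add_one_self) auto
  then have "((\<integral>x. forward \<psi>' x \<partial>\<mu>) - (\<integral>x. forward \<psi> x \<partial>\<mu>)) / e \<le> 0"
    using forward_integrable[OF assms] forward_integrable[OF adm'] using mu.prob_space by (simp add: one)
  then show ?thesis using e by (simp add: \<psi>'_def divide_le_0_iff)
qed

text \<open>
  Instead of proving that Sinkhorn iteration converges or that a minimizer exists, take an admissible potential
  whose dual value is within \<open>d\<close> of the infimum. A further Sinkhorn step stays in the class, so it
  cannot gain more than \<open>d\<close>.
\<close>
lemma ex_nearly_stationary: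
  assumes "d > 0"
  shows "\<exists>\<psi>. admissible \<psi> \<and> (\<integral>y. \<psi> y - sinkhorn \<psi> y \<partial>\<nu>) \<le> d"
proof -
  let ?S = "dual_value ` Collect admissible"
  have bdd: "bdd_below ?S" using dual_value_ge by (auto intro!: bdd_belowI)
  have ne: "?S \<noteq> {}" using admissible_half_square by blast
  obtain \<psi> where \<psi>: "admissible \<psi>" "dual_value \<psi> < Inf ?S + d"
    using cInf_lessD[OF ne, of "Inf ?S + d"] assms by auto
  have "Inf ?S \<le> dual_value (sinkhorn \<psi>)"
    using admissible_sinkhorn[OF \<psi>(1)] bdd by (intro cInf_lower) auto
  then have "(\<integral>y. \<psi> y \<partial>\<nu>) - (\<integral>y. sinkhorn \<psi> y \<partial>\<nu>) \<le> d"
    using \<psi>(2) integral_forward_decreasing[OF \<psi>(1)] by (simp add: dual_value_def)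
  moreover have "(\<integral>y. \<psi> y - sinkhorn \<psi> y \<partial>\<nu>) = (\<integral>y. \<psi> y \<partial>\<nu>) - (\<integral>y. sinkhorn \<psi> y \<partial>\<nu>)"
    using \<psi>(1) admissible_sinkhorn[OF \<psi>(1)] by (intro Bochner_Integration.integral_diff) (auto simp: admissible_def)
  ultimately show ?thesis using \<psi>(1) by auto
qed

end

section \<open>Concentration on the barycentric map\<close>

text \<open>
  A pointwise substitute for Pinsker's inequality: it follows from \<open>(sqrt r - 1)\<^sup>2 \<le> r - 1 - ln r\<close> and a
  weighted inequality between arithmetic and geometric means. Integrated against a probability
  measure it bounds the total variation by the relative entropy.
\<close>
lemma abs_diff_one_le:
  fixes r s :: real
  assumes r: "r > 0" and s: "s > 0"
  shows "\<bar>r - 1\<bar> \<le> (r - 1 - ln r) / (2 * s) + s * (r + 1)"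
proof -
  define q where "q = sqrt r"
  have q: "q > 0" "r = q\<^sup>2" using r by (auto simp: q_def)
  have "ln r = 2 * ln q" using q by (simp add: ln_realpow)
  also have "\<dots> \<le> 2 * (q - 1)" using ln_le_minus_one[OF q(1)] by simp
  finally have "(q - 1)\<^sup>2 \<le> r - 1 - ln r" using q by (simp add: power2_eq_square algebra_simps)
  then have "(q - 1)\<^sup>2 / (2 * s) \<le> (r - 1 - ln r) / (2 * s)" using s by (intro divide_right_mono) auto
  moreover have "(q + 1)\<^sup>2 \<le> 2 * (r + 1)"
    using zero_le_power2[of "q - 1"] unfolding q(2) by (simp add: power2_eq_square algebra_simps)
  then have "s * ((q + 1)\<^sup>2 / 2) \<le> s * (r + 1)" using s by (intro mult_left_mono) auto
  moreover have "\<bar>q - 1\<bar> * (q + 1) \<le> (q - 1)\<^sup>2 / (2 * s) + s * ((q + 1)\<^sup>2 / 2)"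
  proof -
    have "2 * s * (a * b) \<le> a\<^sup>2 + s\<^sup>2 * b\<^sup>2" for a b
      using zero_le_power2[of "a - s * b"] by (simp add: power2_eq_square algebra_simps)
    then have "a * b \<le> (a\<^sup>2 + s\<^sup>2 * b\<^sup>2) / (2 * s)" for a b
      using s by (simp add: pos_le_divide_eq mult.commute)
    also have "(a\<^sup>2 + s\<^sup>2 * b\<^sup>2) / (2 * s) = a\<^sup>2 / (2 * s) + s * (b\<^sup>2 / 2)" for a b
      using s by (simp add: add_divide_distrib power2_eq_square)
    finally have "\<bar>q - 1\<bar> * (q + 1) \<le> \<bar>q - 1\<bar>\<^sup>2 / (2 * s) + s * ((q + 1)\<^sup>2 / 2)" .
    then show ?thesis by simp
  qed
  moreover have "\<bar>r - 1\<bar> = \<bar>q - 1\<bar> * (q + 1)"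
  proof -
    have "r - 1 = (q - 1) * (q + 1)" unfolding q(2) by (simp add: power2_eq_square algebra_simps)
    then show ?thesis using q by (simp add: abs_mult)
  qed
  ultimately show ?thesis by linarith
qed

lemma square_le_exp_sum: "z\<^sup>2 / 4 \<le> exp z + exp (- z) - 2" for z :: real
proof -
  have *: "z\<^sup>2 / 4 \<le> exp z + exp (- z) - 2" if "z \<ge> 0" for z :: real
  proof -
    have "1 + z / 2 \<le> exp (z / 2)" by (rule exp_ge_add_one_self)
    moreover have "exp (- z / 2) \<le> 1" using that by simp
    ultimately have "z / 2 \<le> exp (z / 2) - exp (- z / 2)" by linarith
    then have "(z / 2)\<^sup>2 \<le> (exp (z / 2) - exp (- z / 2))\<^sup>2"
      using that by (intro power_mono) auto
    also have "\<dots> = exp z + exp (- z) - 2"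
      by (simp add: power2_eq_square algebra_simps flip: exp_add)
    finally show ?thesis by (simp add: power_divide)
  qed
  show ?thesis using *[of z] *[of "- z"] by (cases "z \<ge> 0") auto
qed

context contraction_pair
begin

lemma ex_nearly_exact_second_marginal:
  assumes t: "t > 0"
  shows "\<exists>\<psi>. admissible \<psi> \<and> (\<integral>y. \<bar>exp ((sinkhorn \<psi> y - \<psi> y) / e) - 1\<bar> \<partial>\<nu>) \<le> t"
proof -
  obtain \<psi> where \<psi>: "admissible \<psi>" "(\<integral>y. \<psi> y - sinkhorn \<psi> y \<partial>\<nu>) \<le> e * t\<^sup>2 / 4"
    using ex_nearly_stationary[of "e * t\<^sup>2 / 4"] e t by auto
  let ?r = "\<lambda>y. exp ((sinkhorn \<psi> y - \<psi> y) / e)"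
  have int: "integrable \<nu> ?r" "integrable \<nu> \<psi>" "integrable \<nu> (sinkhorn \<psi>)"
    using marginal_ratio[OF \<psi>(1)] \<psi>(1) admissible_sinkhorn[OF \<psi>(1)] by (auto simp: admissible_def)
  have "(\<integral>y. \<bar>?r y - 1\<bar> \<partial>\<nu>) \<le> (\<integral>y. (?r y - 1 + (\<psi> y - sinkhorn \<psi> y) / e) / (t / 2) + t / 4 * (?r y + 1) \<partial>\<nu>)"
  proof (rule integral_mono)
    fix y
    \<comment> \<open>The weight \<open>t / 4\<close> splits the error evenly: each of the two terms contributes \<open>t / 2\<close>.\<close>
    have "\<bar>?r y - 1\<bar> \<le> (?r y - 1 - ln (?r y)) / (2 * (t / 4)) + t / 4 * (?r y + 1)"
      using t by (intro abs_diff_one_le) auto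
    moreover have "?r y - 1 - ln (?r y) = ?r y - 1 + (\<psi> y - sinkhorn \<psi> y) / e" "2 * (t / 4) = t / 2"
      by (simp_all add: diff_divide_distrib)
    ultimately show "\<bar>?r y - 1\<bar> \<le> (?r y - 1 + (\<psi> y - sinkhorn \<psi> y) / e) / (t / 2) + t / 4 * (?r y + 1)"
      by (simp only:)
  qed (use int in auto)
  also have "\<dots> = ((\<integral>y. \<psi> y - sinkhorn \<psi> y \<partial>\<nu>) / e) / (t / 2) + t / 4 * 2"
    using int marginal_ratio(2)[OF \<psi>(1)] nu.prob_space by simp
  also have "\<dots> \<le> (e * t\<^sup>2 / 4 / e) / (t / 2) + t / 4 * 2"
    using \<psi>(2) e t by (intro add_right_mono divide_right_mono) auto
  also have "\<dots> = t" using e t by (simp add: power2_eq_square)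
  finally show ?thesis using \<psi>(1) by blast
qed

lemma plan_integrable_prod:
  assumes "admissible \<psi>"
  shows "integrable (\<mu> \<Otimes>\<^sub>M \<nu>) (\<lambda>(x, y). plan \<psi> x y)"
proof (rule Fubini_integrable)
  note [measurable] = plan_measurable[OF assms]
  show "(\<lambda>(x, y). plan \<psi> x y) \<in> borel_measurable (\<mu> \<Otimes>\<^sub>M \<nu>)" by measurable
qed (use plan_first_marginal[OF assms] plan_pos in \<open>auto simp: less_imp_le abs_of_nonneg\<close>)

text \<open>
  By Fubini's theorem the integral of \<open>F y\<close> against the plan is one against its second marginal, whose density with
  respect to \<open>\<nu>\<close> is \<open>exp ((sinkhorn \<psi> y - \<psi> y) / e)\<close>.
\<close>
lemma plan_second_marginal_test:
  assumes adm: "admissible \<psi>" and [measurable]: "F \<in> borel_measurable borel"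
    and B: "\<And>y. \<bar>F y\<bar> \<le> (B::real)"
  shows "\<bar>(\<integral>x. (\<integral>y. plan \<psi> x y * F y \<partial>\<nu>) \<partial>\<mu>) - (\<integral>y. F y \<partial>\<nu>)\<bar>
    \<le> B * (\<integral>y. \<bar>exp ((sinkhorn \<psi> y - \<psi> y) / e) - 1\<bar> \<partial>\<nu>)"
proof -
  note [measurable] = plan_measurable[OF adm] sinkhorn_measurable[OF adm] admissible_measurable[OF adm]
  let ?r = "\<lambda>y. exp ((sinkhorn \<psi> y - \<psi> y) / e)"
  have F: "integrable \<nu> F" using B by (intro nu.integrable_const_bound[where B=B]) auto
  have intB: "integrable M (\<lambda>z. g z * f z)"
    if "integrable M g" "f \<in> borel_measurable M" "\<And>z. \<bar>f z\<bar> \<le> B" for M :: "'b measure" and g f :: "'b \<Rightarrow> real"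
    using that(1)
    by (intro Bochner_Integration.integrable_bound[of M "\<lambda>z. B * g z" "\<lambda>z. g z * f z"])
      (use that in \<open>auto simp: abs_mult mult.commute intro!: AE_I2 mult_mono intro: order_trans[OF _ abs_ge_self]\<close>)
  have "integrable (\<mu> \<Otimes>\<^sub>M \<nu>) (\<lambda>z. (case z of (x, y) \<Rightarrow> plan \<psi> x y) * F (snd z))"
    by (rule intB[OF plan_integrable_prod[OF adm]]) (auto simp: B)
  moreover have intrF: "integrable \<nu> (\<lambda>y. ?r y * F y)"
    by (rule intB[OF marginal_ratio(1)[OF adm]]) (auto simp: B)
  ultimately have "(\<integral>x. (\<integral>y. plan \<psi> x y * F y \<partial>\<nu>) \<partial>\<mu>) = (\<integral>y. (\<integral>x. plan \<psi> x y * F y \<partial>\<mu>) \<partial>\<nu>)"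
    by (intro Fubini_integral[symmetric]) (simp add: case_prod_beta')
  also have "\<dots> = (\<integral>y. ?r y * F y \<partial>\<nu>)"
    by (rule integral_cong_AE) (use AE_nu in \<open>auto elim!: eventually_mono simp: plan_second_marginal[OF adm]\<close>)
  finally have "(\<integral>x. (\<integral>y. plan \<psi> x y * F y \<partial>\<nu>) \<partial>\<mu>) - (\<integral>y. F y \<partial>\<nu>) = (\<integral>y. ?r y * F y - F y \<partial>\<nu>)"
    using F intrF by simp
  also have "\<bar>\<dots>\<bar> \<le> (\<integral>y. \<bar>?r y * F y - F y\<bar> \<partial>\<nu>)" by (rule integral_abs_bound)
  also have "\<dots> \<le> (\<integral>y. B * \<bar>?r y - 1\<bar> \<partial>\<nu>)"
  proof (rule integral_mono)
    fix y
    have "\<bar>?r y * F y - F y\<bar> = \<bar>F y\<bar> * \<bar>?r y - 1\<bar>" by (simp add: abs_mult[symmetric] algebra_simps)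
    also have "\<dots> \<le> B * \<bar>?r y - 1\<bar>" by (intro mult_right_mono B) auto
    finally show "\<bar>?r y * F y - F y\<bar> \<le> B * \<bar>?r y - 1\<bar>" .
  qed (intro integrable_abs Bochner_Integration.integrable_diff F intrF integrable_mult_right
      marginal_ratio(1)[OF adm] nu.integrable_const)+
  also have "\<dots> = B * (\<integral>y. \<bar>?r y - 1\<bar> \<partial>\<nu>)" by simp
  finally show ?thesis .
qed

text \<open>
  The conditional expectation of the second coordinate of the plan given that the first is \<open>x\<close>. It is the gradient
  of the forward conjugate.
\<close>
definition barycenter :: "('a \<Rightarrow> real) \<Rightarrow> 'a \<Rightarrow> 'a" where
  "barycenter \<psi> x = (\<integral>y. plan \<psi> x y *\<^sub>R y \<partial>\<nu>)"

lemma plan_section_measurable: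
  assumes "admissible \<psi>"
  shows "plan \<psi> x \<in> borel_measurable borel"
  using measurable_compose_Pair1[OF _ plan_measurable[OF assms], of x] by simp

lemma integrable_plan_bounded:
  fixes f :: "'a \<Rightarrow> real"
  assumes adm: "admissible \<psi>" and f: "f \<in> borel_measurable borel" and B: "\<And>y. y \<in> U \<Longrightarrow> \<bar>f y\<bar> \<le> B"
  shows "integrable \<nu> (\<lambda>y. plan \<psi> x y * f y)"
proof (rule Bochner_Integration.integrable_bound)
  show "integrable \<nu> (\<lambda>y. B * plan \<psi> x y)" using plan_first_marginal[OF adm] by auto
  show "(\<lambda>y. plan \<psi> x y * f y) \<in> borel_measurable \<nu>"
    using plan_section_measurable[OF adm] f by simp
  show "AE y in \<nu>. norm (plan \<psi> x y * f y) \<le> norm (B * plan \<psi> x y)"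
    using AE_nu
  proof (rule eventually_mono)
    fix y assume "y \<in> U"
    then have "\<bar>f y\<bar> \<le> \<bar>B\<bar>" using B by force
    then show "norm (plan \<psi> x y * f y) \<le> norm (B * plan \<psi> x y)"
      by (simp add: abs_mult mult.commute mult_right_mono)
  qed
qed

lemma integrable_plan_id:
  assumes adm: "admissible \<psi>"
  shows "integrable \<nu> (\<lambda>y. plan \<psi> x y *\<^sub>R y)"
proof (rule Bochner_Integration.integrable_bound)
  show "integrable \<nu> (\<lambda>y. R * plan \<psi> x y)" using plan_first_marginal[OF adm] by auto
  show "(\<lambda>y. plan \<psi> x y *\<^sub>R y) \<in> borel_measurable \<nu>"
    using plan_section_measurable[OF adm] by simp
  show "AE y in \<nu>. norm (plan \<psi> x y *\<^sub>R y) \<le> norm (R * plan \<psi> x y)"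
    using AE_nu
  proof (rule eventually_mono)
    fix y assume "y \<in> U"
    then have "norm y \<le> R" using R by simp
    then show "norm (plan \<psi> x y *\<^sub>R y) \<le> norm (R * plan \<psi> x y)"
      using R_nonneg by (simp add: abs_mult mult.commute mult_right_mono)
  qed
qed

lemma norm_barycenter_le:
  assumes adm: "admissible \<psi>"
  shows "norm (barycenter \<psi> x) \<le> R"
proof -
  have "norm (barycenter \<psi> x) \<le> (\<integral>y. norm (plan \<psi> x y *\<^sub>R y) \<partial>\<nu>)"
    unfolding barycenter_def by (rule integral_norm_bound)
  also have "\<dots> \<le> (\<integral>y. R * plan \<psi> x y \<partial>\<nu>)"
  proof (rule integral_mono_AE)
    show "integrable \<nu> (\<lambda>y. norm (plan \<psi> x y *\<^sub>R y))" using integrable_plan_id[OF adm] by (rule integrable_norm)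
    show "integrable \<nu> (\<lambda>y. R * plan \<psi> x y)" using plan_first_marginal[OF adm] by auto
    show "AE y in \<nu>. norm (plan \<psi> x y *\<^sub>R y) \<le> R * plan \<psi> x y"
      using AE_nu by (rule eventually_mono) (use R plan_pos in \<open>auto simp: less_imp_le mult.commute intro!: mult_right_mono\<close>)
  qed
  also have "\<dots> = R" using plan_first_marginal[OF adm] by simp
  finally show ?thesis .
qed

lemma inner_barycenter:
  assumes adm: "admissible \<psi>"
  shows "(\<integral>y. plan \<psi> x y * inner z y \<partial>\<nu>) = inner z (barycenter \<psi> x)"
  unfolding barycenter_def
  using integral_inner_right[of z \<nu> "\<lambda>y. plan \<psi> x y *\<^sub>R y"] integrable_plan_id[OF adm, of x]
  by (simp add: mult.commute)

text \<open>
  The increments of the forward conjugate are the logarithmic moment generating function of the conditional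
  laws of the plan. Convexity and curvature of the forward conjugate thereby give the subgradient property of
  the barycenter and the concentration around it.
\<close>
lemma plan_exponential_moment:
  assumes adm: "admissible \<psi>"
  shows "integrable \<nu> (\<lambda>y. plan \<psi> x y * exp (inner z y / e))"
    and "(\<integral>y. plan \<psi> x y * exp (inner z y / e) \<partial>\<nu>) = exp ((forward \<psi> (x + z) - forward \<psi> x) / e)"
proof -
  have k: "plan \<psi> x y * exp (inner z y / e) = exp (- forward \<psi> x / e) * exp ((inner (x + z) y - \<psi> y) / e)" for y
    by (simp add: plan_def inner_add_left add_divide_distrib diff_divide_distrib flip: exp_add)
  show "integrable \<nu> (\<lambda>y. plan \<psi> x y * exp (inner z y / e))"
    unfolding k by (intro integrable_mult_right integrable_exp_nu adm)
  show "(\<integral>y. plan \<psi> x y * exp (inner z y / e) \<partial>\<nu>) = exp ((forward \<psi> (x + z) - forward \<psi> x) / e)"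
    unfolding k integral_mult_right_zero
      soft_conjugate_normalizes[OF prob_nu e integrable_exp_nu[OF adm], symmetric]
    by (simp add: diff_divide_distrib flip: exp_add)
qed

lemma inner_bounded_on_U: "y \<in> U \<Longrightarrow> \<bar>inner z y\<bar> \<le> norm z * R"
  by (rule order_trans[OF Cauchy_Schwarz_ineq2]) (intro mult_left_mono R, auto)

text \<open>
  Jensen's inequality for the conditional law of the plan.
\<close>
lemma barycenter_subgradient:
  assumes adm: "admissible \<psi>"
  shows "inner (barycenter \<psi> x) z \<le> forward \<psi> (x + z) - forward \<psi> x"
proof -
  define c where "c = inner (barycenter \<psi> x) z / e"
  have int: "integrable \<nu> (\<lambda>y. plan \<psi> x y * inner z y)"
    by (rule integrable_plan_bounded[OF adm]) (auto intro: inner_bounded_on_U)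
  have "(\<integral>y. exp c * ((1 - c) * plan \<psi> x y + plan \<psi> x y * inner z y / e) \<partial>\<nu>)
      \<le> (\<integral>y. plan \<psi> x y * exp (inner z y / e) \<partial>\<nu>)"
  proof (rule integral_mono)
    fix y
    have "exp c * (1 + (inner z y / e - c)) \<le> exp (inner z y / e)"
      using mult_left_mono[OF exp_ge_add_one_self[of "inner z y / e - c"], of "exp c"] by (simp flip: exp_add)
    then have "plan \<psi> x y * (exp c * (1 + (inner z y / e - c))) \<le> plan \<psi> x y * exp (inner z y / e)"
      using plan_pos[of \<psi> x y] by (intro mult_left_mono) auto
    then show "exp c * ((1 - c) * plan \<psi> x y + plan \<psi> x y * inner z y / e) \<le> plan \<psi> x y * exp (inner z y / e)"
      by (simp add: algebra_simps)
  qed (use int plan_first_marginal[OF adm] plan_exponential_moment[OF adm] in auto)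
  also have "(\<integral>y. exp c * ((1 - c) * plan \<psi> x y + plan \<psi> x y * inner z y / e) \<partial>\<nu>) = exp c"
    using int plan_first_marginal[OF adm] inner_barycenter[OF adm, of x z]
    by (simp add: c_def inner_commute)
  finally have "exp c \<le> exp ((forward \<psi> (x + z) - forward \<psi> x) / e)"
    unfolding plan_exponential_moment[OF adm] .
  then show ?thesis using e by (simp add: c_def divide_le_cancel)
qed

text \<open>
  The curvature bound on the forward conjugate bounds the exponential moments of the deviation from the barycenter
  in the directions \<open>z\<close> and \<open>- z\<close>, and their sum dominates the second moment.
\<close>
lemma plan_variance_direction:
  assumes adm: "admissible \<psi>"
  shows "(\<integral>y. plan \<psi> x y * (inner z (y - barycenter \<psi> x) / e)\<^sup>2 \<partial>\<nu>) \<le> 8 * (exp ((norm z)\<^sup>2 / e) - 1)"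
proof -
  define T where "T = barycenter \<psi> x"
  have upper: "forward \<psi> (x + v) - forward \<psi> x - inner v T \<le> (norm v)\<^sup>2" for v
    using forward_second_difference[OF adm, of x v] barycenter_subgradient[OF adm, of x "- v"]
    by (simp add: T_def inner_commute)
  have expmom: "integrable \<nu> (\<lambda>y. plan \<psi> x y * exp (inner v (y - T) / e))"
    "(\<integral>y. plan \<psi> x y * exp (inner v (y - T) / e) \<partial>\<nu>) \<le> exp ((norm v)\<^sup>2 / e)" for v
  proof -
    have k: "plan \<psi> x y * exp (inner v (y - T) / e) = exp (- inner v T / e) * (plan \<psi> x y * exp (inner v y / e))" for y
      by (simp add: inner_diff_right diff_divide_distrib exp_diff exp_minus field_simps)
    show "integrable \<nu> (\<lambda>y. plan \<psi> x y * exp (inner v (y - T) / e))"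
      unfolding k by (intro integrable_mult_right plan_exponential_moment adm)
    have "(\<integral>y. plan \<psi> x y * exp (inner v (y - T) / e) \<partial>\<nu>) = exp ((forward \<psi> (x + v) - forward \<psi> x - inner v T) / e)"
      unfolding k integral_mult_right_zero plan_exponential_moment[OF adm]
      by (simp add: diff_divide_distrib flip: exp_add)
    also have "\<dots> \<le> exp ((norm v)\<^sup>2 / e)" using upper[of v] e by (simp add: divide_right_mono)
    finally show "(\<integral>y. plan \<psi> x y * exp (inner v (y - T) / e) \<partial>\<nu>) \<le> exp ((norm v)\<^sup>2 / e)" .
  qed
  have "(\<integral>y. plan \<psi> x y * (inner z (y - T) / e)\<^sup>2 \<partial>\<nu>)
    \<le> (\<integral>y. 4 * (plan \<psi> x y * exp (inner z (y - T) / e) + plan \<psi> x y * exp (inner (- z) (y - T) / e) - 2 * plan \<psi> x y) \<partial>\<nu>)"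
  proof (rule integral_mono)
    have "\<bar>(inner z (y - T) / e)\<^sup>2\<bar> \<le> ((norm z * R + \<bar>inner z T\<bar>) / e)\<^sup>2" if "y \<in> U" for y
    proof -
      have "\<bar>inner z (y - T)\<bar> \<le> norm z * R + \<bar>inner z T\<bar>"
        using inner_bounded_on_U[OF that, of z] by (simp add: inner_diff_right)
      then have "\<bar>inner z (y - T)\<bar> / e \<le> (norm z * R + \<bar>inner z T\<bar>) / e" using e by (simp add: divide_right_mono)
      then have "(\<bar>inner z (y - T)\<bar> / e)\<^sup>2 \<le> ((norm z * R + \<bar>inner z T\<bar>) / e)\<^sup>2"
        using e by (intro power_mono) auto
      then show ?thesis by (simp add: power_divide)
    qed
    then show "integrable \<nu> (\<lambda>y. plan \<psi> x y * (inner z (y - T) / e)\<^sup>2)"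
      by (intro integrable_plan_bounded[OF adm]) auto
    fix y
    have "plan \<psi> x y * ((inner z (y - T) / e)\<^sup>2 / 4)
        \<le> plan \<psi> x y * (exp (inner z (y - T) / e) + exp (- (inner z (y - T) / e)) - 2)"
      using plan_pos[of \<psi> x y] by (intro mult_left_mono square_le_exp_sum) auto
    moreover have "inner (- z) (y - T) / e = - (inner z (y - T) / e)" by simp
    ultimately show "plan \<psi> x y * (inner z (y - T) / e)\<^sup>2
      \<le> 4 * (plan \<psi> x y * exp (inner z (y - T) / e) + plan \<psi> x y * exp (inner (- z) (y - T) / e) - 2 * plan \<psi> x y)"
      by (simp only: distrib_left right_diff_distrib)
  qed (use expmom(1)[of z] expmom(1)[of "- z"] plan_first_marginal[OF adm] in auto)
  also have "\<dots> = 4 * ((\<integral>y. plan \<psi> x y * exp (inner z (y - T) / e) \<partial>\<nu>)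
      + (\<integral>y. plan \<psi> x y * exp (inner (- z) (y - T) / e) \<partial>\<nu>) - 2)"
    using expmom(1)[of z] expmom(1)[of "- z"] plan_first_marginal[OF adm] by simp
  also have "\<dots> \<le> 8 * (exp ((norm z)\<^sup>2 / e) - 1)"
    using expmom(2)[of z] expmom(2)[of "- z"] by simp
  finally show ?thesis by (simp add: T_def)
qed

text \<open>
  Taking \<open>z\<close> of length \<open>sqrt e\<close> in the variance bound balances the factor \<open>1 / e\<close> in the exponent, so the
  conditional variance is of order \<open>e\<close>: as the temperature vanishes the plan concentrates on the graph of its
  barycenter.
\<close>
lemma plan_mean_deviation:
  assumes adm: "admissible \<psi>"
  shows "integrable \<nu> (\<lambda>y. plan \<psi> x y * norm (y - barycenter \<psi> x))"
    and "(\<integral>y. plan \<psi> x y * norm (y - barycenter \<psi> x) \<partial>\<nu>) \<le> (16 * DIM('a) + 1) * sqrt e"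
proof -
  define T where "T = barycenter \<psi> x"
  have bdd: "norm (y - T) \<le> 2 * R" if "y \<in> U" for y
    using norm_triangle_ineq4[of y T] R[OF that] norm_barycenter_le[OF adm, of x] by (simp add: T_def)
  show int: "integrable \<nu> (\<lambda>y. plan \<psi> x y * norm (y - barycenter \<psi> x))"
    using bdd by (intro integrable_plan_bounded[OF adm]) (auto simp: T_def)
  have int2: "integrable \<nu> (\<lambda>y. plan \<psi> x y * (inner b (y - T))\<^sup>2)" if "b \<in> Basis" for b
  proof (rule integrable_plan_bounded[OF adm])
    fix y assume y: "y \<in> U"
    have "\<bar>inner b (y - T)\<bar> \<le> 2 * R"
      using Basis_le_norm[OF that, of "y - T"] bdd[OF y] by (simp add: inner_commute)
    then have "\<bar>inner b (y - T)\<bar>\<^sup>2 \<le> (2 * R)\<^sup>2" by (intro power_mono) auto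
    then show "\<bar>(inner b (y - T))\<^sup>2\<bar> \<le> (2 * R)\<^sup>2" by simp
  qed auto
  have dir: "(\<integral>y. plan \<psi> x y * (inner b (y - T))\<^sup>2 \<partial>\<nu>) \<le> 16 * e" if b: "b \<in> Basis" for b
  proof -
    have eq: "plan \<psi> x y * (inner (sqrt e *\<^sub>R b) (y - T) / e)\<^sup>2 = (plan \<psi> x y * (inner b (y - T))\<^sup>2) / e" for y
      using e by (simp add: power_divide power_mult_distrib power2_eq_square[of e])
    have "(\<integral>y. plan \<psi> x y * (inner b (y - T))\<^sup>2 \<partial>\<nu>) / e \<le> 8 * (exp ((norm (sqrt e *\<^sub>R b))\<^sup>2 / e) - 1)"
      using plan_variance_direction[OF adm, of x "sqrt e *\<^sub>R b"] unfolding T_def[symmetric] eq by simp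
    also have "\<dots> = 8 * (exp 1 - 1)" using e b by simp
    also have "\<dots> \<le> 16" using exp_le by simp
    finally show ?thesis using e by (simp add: divide_le_eq mult.commute)
  qed
  have "plan \<psi> x y * norm (y - T) \<le> (\<Sum>b\<in>Basis. plan \<psi> x y * (inner b (y - T))\<^sup>2) / sqrt e + sqrt e * plan \<psi> x y" for y
  proof -
    have "0 \<le> (norm (y - T) - sqrt e)\<^sup>2 / sqrt e" using e by simp
    also have "\<dots> = (norm (y - T))\<^sup>2 / sqrt e + sqrt e - 2 * norm (y - T)"
      using e by (simp add: power2_diff diff_divide_distrib add_divide_distrib real_div_sqrt)
    finally have "norm (y - T) \<le> (norm (y - T))\<^sup>2 / sqrt e + sqrt e"
      using norm_ge_zero[of "y - T"] by linarith
    then have "plan \<psi> x y * norm (y - T) \<le> plan \<psi> x y * ((norm (y - T))\<^sup>2 / sqrt e + sqrt e)"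
      using plan_pos[of \<psi> x y] by (intro mult_left_mono) auto
    also have "\<dots> = (plan \<psi> x y * (norm (y - T))\<^sup>2) / sqrt e + sqrt e * plan \<psi> x y"
      by (simp add: algebra_simps)
    also have "(norm (y - T))\<^sup>2 = (\<Sum>b\<in>Basis. (inner b (y - T))\<^sup>2)"
      unfolding power2_norm_eq_inner by (subst euclidean_inner) (simp add: power2_eq_square inner_commute)
    finally show ?thesis by (simp add: sum_distrib_left)
  qed
  then have "(\<integral>y. plan \<psi> x y * norm (y - T) \<partial>\<nu>)
      \<le> (\<integral>y. (\<Sum>b\<in>Basis. plan \<psi> x y * (inner b (y - T))\<^sup>2) / sqrt e + sqrt e * plan \<psi> x y \<partial>\<nu>)"
    using int int2 plan_first_marginal[OF adm] by (intro integral_mono) (auto simp: T_def)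
  also have "\<dots> = (\<Sum>b\<in>Basis. (\<integral>y. plan \<psi> x y * (inner b (y - T))\<^sup>2 \<partial>\<nu>)) / sqrt e + sqrt e"
    using int2 plan_first_marginal[OF adm] by (simp add: integral_sum)
  also have "\<dots> \<le> (\<Sum>b\<in>(Basis::'a set). 16 * e) / sqrt e + sqrt e"
    using e by (intro add_right_mono divide_right_mono sum_mono dir) auto
  also have "\<dots> = (16 * DIM('a) + 1) * sqrt e"
  proof -
    have "(\<Sum>b\<in>(Basis::'a set). 16 * e) / sqrt e = 16 * DIM('a) * (e / sqrt e)" by simp
    also have "e / sqrt e = sqrt e" using e by (simp add: real_div_sqrt)
    finally show ?thesis by (simp add: algebra_simps)
  qed
  finally show "(\<integral>y. plan \<psi> x y * norm (y - barycenter \<psi> x) \<partial>\<nu>) \<le> (16 * DIM('a) + 1) * sqrt e"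
    by (simp add: T_def)
qed

lemma barycenter_measurable [measurable]:
  assumes "admissible \<psi>"
  shows "barycenter \<psi> \<in> borel_measurable borel"
proof -
  note [measurable] = plan_measurable[OF assms]
  show ?thesis unfolding barycenter_def[abs_def] by measurable
qed

text \<open>
  At positive temperature, the barycenter of a nearly optimal plan is a nonexpansive gradient that transports
  \<open>\<mu>\<close> to a measure near \<open>\<nu>\<close>. The first error term comes from replacing the conditional law by its
  mean, the second from the inexact second marginal.
\<close>
theorem ex_approximate_map:
  assumes t: "t > 0"
  shows "\<exists>\<phi> T. (\<forall>x z. inner (T x) z \<le> \<phi> (x + z) - \<phi> x) \<and>
    (\<forall>x z. \<phi> (x + z) + \<phi> (x - z) - 2 * \<phi> x \<le> (norm z)\<^sup>2) \<and>
    (\<forall>x. norm (T x) \<le> R) \<and>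
    (\<forall>F L B. (\<forall>x y. \<bar>F x - F y\<bar> \<le> L * norm (x - y)) \<longrightarrow> (\<forall>x. \<bar>F x\<bar> \<le> B) \<longrightarrow>
      \<bar>(\<integral>x. F (T x) \<partial>\<mu>) - (\<integral>y. F y \<partial>\<nu>)\<bar> \<le> L * ((16 * DIM('a) + 1) * sqrt e) + B * t)"
proof -
  obtain \<psi> where adm: "admissible \<psi>" and close: "(\<integral>y. \<bar>exp ((sinkhorn \<psi> y - \<psi> y) / e) - 1\<bar> \<partial>\<nu>) \<le> t"
    using ex_nearly_exact_second_marginal[OF t] by blast
  let ?T = "barycenter \<psi>"
  note [measurable] = plan_measurable[OF adm] barycenter_measurable[OF adm]
  have test: "\<bar>(\<integral>x. F (?T x) \<partial>\<mu>) - (\<integral>y. F y \<partial>\<nu>)\<bar> \<le> L * ((16 * DIM('a) + 1) * sqrt e) + B * t"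
    if L: "\<And>x y. \<bar>F x - F y\<bar> \<le> L * norm (x - y)" and B: "\<And>x. \<bar>F x\<bar> \<le> B" for F L B
  proof -
    have L0: "0 \<le> L" and "continuous_on UNIV F" using lipschitz_function_regularity[OF L] by auto
    then have [measurable]: "F \<in> borel_measurable borel" by (intro borel_measurable_continuous_onI)
    have B0: "0 \<le> B" using B[of 0] by linarith
    let ?E = "\<lambda>x. \<integral>y. plan \<psi> x y * F y \<partial>\<nu>"
    have intF: "integrable \<nu> (\<lambda>y. plan \<psi> x y * F y)" for x
      using B by (intro integrable_plan_bounded[OF adm]) auto
    have near: "\<bar>F (?T x) - ?E x\<bar> \<le> L * ((16 * DIM('a) + 1) * sqrt e)" for x
    proof -
      have "F (?T x) - ?E x = (\<integral>y. plan \<psi> x y * F (?T x) - plan \<psi> x y * F y \<partial>\<nu>)"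
        using plan_first_marginal[OF adm] intF by simp
      also have "\<bar>\<dots>\<bar> \<le> (\<integral>y. \<bar>plan \<psi> x y * F (?T x) - plan \<psi> x y * F y\<bar> \<partial>\<nu>)" by (rule integral_abs_bound)
      also have "\<dots> \<le> (\<integral>y. L * (plan \<psi> x y * norm (y - ?T x)) \<partial>\<nu>)"
      proof (rule integral_mono)
        fix y
        have "\<bar>plan \<psi> x y * F (?T x) - plan \<psi> x y * F y\<bar> = plan \<psi> x y * \<bar>F y - F (?T x)\<bar>"
          using plan_pos[of \<psi> x y] by (simp add: abs_mult abs_minus_commute flip: right_diff_distrib)
        also have "\<dots> \<le> plan \<psi> x y * (L * norm (y - ?T x))"
          using plan_pos[of \<psi> x y] by (intro mult_left_mono L) auto
        finally show "\<bar>plan \<psi> x y * F (?T x) - plan \<psi> x y * F y\<bar> \<le> L * (plan \<psi> x y * norm (y - ?T x))"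
          by (simp add: mult.left_commute)
      qed (use intF plan_first_marginal[OF adm] plan_mean_deviation[OF adm] in auto)
      also have "\<dots> = L * (\<integral>y. plan \<psi> x y * norm (y - ?T x) \<partial>\<nu>)" by simp
      also have "\<dots> \<le> L * ((16 * DIM('a) + 1) * sqrt e)"
        using L0 by (intro mult_left_mono plan_mean_deviation[OF adm])
      finally show ?thesis .
    qed
    have Em: "?E \<in> borel_measurable borel" by measurable
    have Eb: "\<bar>?E x\<bar> \<le> B + L * ((16 * DIM('a) + 1) * sqrt e)" for x
      using near[of x] B[of "?T x"] by linarith
    have iE: "integrable \<mu> ?E" using Em Eb by (intro mu.integrable_const_bound[where B="B + L * ((16 * DIM('a) + 1) * sqrt e)"]) auto
    have iF: "integrable \<mu> (\<lambda>x. F (?T x))" using B by (intro mu.integrable_const_bound[where B=B]) auto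
    have "\<bar>(\<integral>x. F (?T x) \<partial>\<mu>) - (\<integral>x. ?E x \<partial>\<mu>)\<bar> = \<bar>\<integral>x. F (?T x) - ?E x \<partial>\<mu>\<bar>"
      using iE iF by simp
    also have "\<dots> \<le> (\<integral>x. \<bar>F (?T x) - ?E x\<bar> \<partial>\<mu>)" by (rule integral_abs_bound)
    also have "\<dots> \<le> L * ((16 * DIM('a) + 1) * sqrt e)"
      using iE iF near by (intro mu.integral_le_const) auto
    finally have "\<bar>(\<integral>x. F (?T x) \<partial>\<mu>) - (\<integral>x. ?E x \<partial>\<mu>)\<bar> \<le> L * ((16 * DIM('a) + 1) * sqrt e)" .
    moreover have "\<bar>(\<integral>x. ?E x \<partial>\<mu>) - (\<integral>y. F y \<partial>\<nu>)\<bar> \<le> B * t"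
      using plan_second_marginal_test[OF adm, of F B] B mult_left_mono[OF close B0] by fastforce
    ultimately show ?thesis by linarith
  qed
  show ?thesis
    using barycenter_subgradient[OF adm] forward_second_difference[OF adm] norm_barycenter_le[OF adm] test
    by (intro exI[of _ "forward \<psi>"] exI[of _ ?T] conjI allI impI) auto
qed

end

section \<open>Limits of convex functions with nonexpansive gradients\<close>

text \<open>
  The second difference bound and the subgradient inequality at \<open>- z\<close> give the estimate with the constant 1 in
  place of \<open>1 / 2\<close>. Halving \<open>z\<close> improves a constant \<open>c\<close> to \<open>1 / 4 + c / 2\<close>, whose fixed point is
  \<open>1 / 2\<close>; the sharp constant is needed for the Lipschitz constant 1.
\<close>
lemma smooth_of_second_difference:
  fixes \<phi> :: "'a::euclidean_space \<Rightarrow> real"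
  assumes sub: "\<And>x z. inner (T x) z \<le> \<phi> (x + z) - \<phi> x"
    and diff2: "\<And>x z. \<phi> (x + z) + \<phi> (x - z) - 2 * \<phi> x \<le> (norm z)\<^sup>2"
  shows "\<phi> (x + z) - \<phi> x - inner (T x) z \<le> (norm z)\<^sup>2 / 2"
proof -
  have iter: "\<phi> (x + z) - \<phi> x - inner (T x) z \<le> (1 / 2 + (1 / 2) ^ Suc n) * (norm z)\<^sup>2" for n z
  proof (induction n arbitrary: z)
    case 0
    then show ?case using diff2[of x z] sub[of x "- z"] by simp
  next
    case (Suc n)
    have half: "z /\<^sub>R 2 + z /\<^sub>R 2 = z" by (simp flip: scaleR_add_left)
    have nhalf: "(norm (z /\<^sub>R 2))\<^sup>2 = (norm z)\<^sup>2 / 4" 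
    proof -
      have "norm (z /\<^sub>R 2) = norm z / 2" by simp
      then show ?thesis by (simp only: power_divide) simp
    qed
    have "\<phi> (x + z) + \<phi> x - 2 * \<phi> (x + z /\<^sub>R 2) \<le> (norm z)\<^sup>2 / 4"
      using diff2[of "x + z /\<^sub>R 2" "z /\<^sub>R 2"] unfolding nhalf add.assoc half by simp
    moreover have "2 * \<phi> (x + z /\<^sub>R 2) - 2 * \<phi> x - inner (T x) z \<le> 2 * ((1 / 2 + (1 / 2) ^ Suc n) * ((norm z)\<^sup>2 / 4))"
    proof -
      have "inner (T x) (z /\<^sub>R 2) = inner (T x) z / 2" by simp
      with Suc.IH[of "z /\<^sub>R 2"] show ?thesis unfolding nhalf by linarith
    qed
    moreover have "(norm z)\<^sup>2 / 4 + 2 * ((1 / 2 + (1 / 2) ^ Suc n) * ((norm z)\<^sup>2 / 4)) = (1 / 2 + (1 / 2) ^ Suc (Suc n)) * (norm z)\<^sup>2"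
      by (simp add: algebra_simps)
    ultimately show ?case by linarith
  qed
  have "(\<lambda>n. (1 / 2 + (1 / 2) ^ Suc n) * (norm z)\<^sup>2) \<longlonglongrightarrow> (1 / 2 + 0) * (norm z)\<^sup>2"
    by (intro tendsto_intros LIMSEQ_Suc LIMSEQ_power_zero) simp
  then have "\<phi> (x + z) - \<phi> x - inner (T x) z \<le> (1 / 2 + 0) * (norm z)\<^sup>2"
    by (rule LIMSEQ_le_const) (use iter in blast)
  then show ?thesis by simp
qed

text \<open>
  Co-coercivity of the gradient: compare the supporting plane at \<open>x\<close> with the quadratic upper bound at \<open>y\<close> in the point
  \<open>y + (T x - T y)\<close>, exchange the roles of \<open>x\<close> and \<open>y\<close>, and add.
\<close>
lemma gradient_nonexpansive:
  fixes \<phi> :: "'a::euclidean_space \<Rightarrow> real"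
  assumes sub: "\<And>x z. inner (T x) z \<le> \<phi> (x + z) - \<phi> x"
    and smooth: "\<And>x z. \<phi> (x + z) - \<phi> x - inner (T x) z \<le> (norm z)\<^sup>2 / 2"
  shows "norm (T x - T y) \<le> norm (x - y)"
proof -
  have key: "\<phi> x + inner (T x) (y - x) + (norm (T x - T y))\<^sup>2 / 2 \<le> \<phi> y" for x y
  proof -
    define d where "d = T x - T y"
    have "inner (T x) (y + d - x) \<le> \<phi> (y + d) - \<phi> x" using sub[of x "y + d - x"] by (simp add: algebra_simps)
    moreover have "\<phi> (y + d) - \<phi> y - inner (T y) d \<le> (norm d)\<^sup>2 / 2" by (rule smooth)
    moreover have "inner (T x) (y + d - x) = inner (T x) (y - x) + inner (T y) d + (norm d)\<^sup>2"
      unfolding power2_norm_eq_inner d_def by (simp add: inner_add_right inner_diff_right inner_diff_left inner_commute)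
    ultimately show ?thesis unfolding d_def[symmetric] by linarith
  qed
  have "(norm (T x - T y))\<^sup>2 \<le> inner (T x - T y) (x - y)"
    using key[of x y] key[of y x] by (simp add: norm_minus_commute inner_diff_left inner_diff_right)
  also have "\<dots> \<le> norm (T x - T y) * norm (x - y)" by (rule norm_cauchy_schwarz)
  finally show ?thesis
    by (cases "T x = T y") (auto simp: power2_eq_square)
qed

lemma gderiv_of_quadratic_bound:
  fixes \<phi> :: "'a::euclidean_space \<Rightarrow> real"
  assumes sub: "\<And>x z. inner (T x) z \<le> \<phi> (x + z) - \<phi> x"
    and smooth: "\<And>x z. \<phi> (x + z) - \<phi> x - inner (T x) z \<le> (norm z)\<^sup>2 / 2"
  shows "GDERIV \<phi> x :> T x"
  unfolding gderiv_def has_derivative_at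
proof (intro conjI)
  show "bounded_linear (\<lambda>h. inner h (T x))" by (rule bounded_linear_inner_left)
  show "(\<lambda>h. norm (\<phi> (x + h) - \<phi> x - inner h (T x)) / norm h) \<midarrow>0\<rightarrow> 0"
  proof (rule tendsto_sandwich[where f = "\<lambda>_. 0" and h = "\<lambda>h. norm h / 2"])
    have "(\<lambda>h::'a. norm h / 2) \<midarrow>0\<rightarrow> norm (0::'a) / 2" by (intro tendsto_intros) simp
    then show "(\<lambda>h::'a. norm h / 2) \<midarrow>0\<rightarrow> 0" by simp
    show "\<forall>\<^sub>F h in at 0. norm (\<phi> (x + h) - \<phi> x - inner h (T x)) / norm h \<le> norm h / 2"
    proof (rule always_eventually, rule allI)
      fix h
      have "norm (\<phi> (x + h) - \<phi> x - inner h (T x)) \<le> (norm h)\<^sup>2 / 2"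
        using sub[of x h] smooth[of x h] by (simp add: inner_commute)
      then show "norm (\<phi> (x + h) - \<phi> x - inner h (T x)) / norm h \<le> norm h / 2"
        by (cases "h = 0") (auto simp: divide_le_eq power2_eq_square)
    qed
  qed (auto intro!: always_eventually)
qed

lemma convex_on_of_subgradient:
  fixes \<phi> :: "'a::euclidean_space \<Rightarrow> real"
  assumes sub: "\<And>x z. inner (T x) z \<le> \<phi> (x + z) - \<phi> x"
  shows "convex_on UNIV \<phi>"
proof (rule convex_onI)
  fix t :: real and x y :: 'a assume t: "0 < t" "t < 1"
  define p where "p = (1 - t) *\<^sub>R x + t *\<^sub>R y"
  have "inner (T p) (x - p) \<le> \<phi> x - \<phi> p" "inner (T p) (y - p) \<le> \<phi> y - \<phi> p"
    using sub[of p "x - p"] sub[of p "y - p"] by simp_all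
  then have "(1 - t) * inner (T p) (x - p) + t * inner (T p) (y - p) \<le> (1 - t) * (\<phi> x - \<phi> p) + t * (\<phi> y - \<phi> p)"
    using t by (intro add_mono mult_left_mono) auto
  moreover have "(1 - t) * inner (T p) (x - p) + t * inner (T p) (y - p) = inner (T p) ((1 - t) *\<^sub>R (x - p) + t *\<^sub>R (y - p))"
    by (simp add: inner_add_right)
  moreover have "(1 - t) *\<^sub>R (x - p) + t *\<^sub>R (y - p) = 0"
    unfolding p_def by (simp add: algebra_simps)
  ultimately have "0 \<le> (1 - t) * (\<phi> x - \<phi> p) + t * (\<phi> y - \<phi> p)" by simp
  also have "\<dots> = (1 - t) * \<phi> x + t * \<phi> y - \<phi> p" by (simp add: algebra_simps)
  finally show "\<phi> ((1 - t) *\<^sub>R x + t *\<^sub>R y) \<le> (1 - t) * \<phi> x + t * \<phi> y"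
    unfolding p_def[symmetric] by simp
qed auto

lemma convergent_of_dense_equilipschitz:
  fixes f :: "nat \<Rightarrow> 'a::metric_space \<Rightarrow> 'b::banach"
  assumes lip: "\<And>n x y. norm (f n x - f n y) \<le> L * dist x y"
    and D: "closure D = UNIV" and conv: "\<And>x. x \<in> D \<Longrightarrow> convergent (\<lambda>n. f n x)"
  shows "convergent (\<lambda>n. f n x)"
proof (rule Cauchy_convergent, rule CauchyI)
  fix \<epsilon> :: real assume eps: "\<epsilon> > 0"
  obtain y where y: "y \<in> D" "dist y x < \<epsilon> / (3 * (\<bar>L\<bar> + 1))"
    using closure_approachable[of x D] D eps by (metis UNIV_I abs_ge_zero add_nonneg_pos divide_pos_pos mult_pos_pos zero_less_numeral zero_less_one)
  have small: "norm (f n x - f n y) < \<epsilon> / 3" for n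
  proof -
    have "norm (f n x - f n y) \<le> L * dist x y" by (rule lip)
    also have "\<dots> \<le> (\<bar>L\<bar> + 1) * dist y x" by (subst dist_commute) (intro mult_right_mono, auto)
    also have "\<dots> < \<epsilon> / 3" using y(2) by (simp add: pos_less_divide_eq add_nonneg_pos algebra_simps)
    finally show ?thesis .
  qed
  obtain N where N: "\<And>m n. m \<ge> N \<Longrightarrow> n \<ge> N \<Longrightarrow> norm (f m y - f n y) < \<epsilon> / 3"
    using CauchyD[OF convergent_Cauchy[OF conv[OF y(1)]], of "\<epsilon> / 3"] eps
    by (metis divide_pos_pos zero_less_numeral)
  show "\<exists>M. \<forall>m\<ge>M. \<forall>n\<ge>M. norm (f m x - f n x) < \<epsilon>"
  proof (intro exI[of _ N] allI impI)
    fix m n assume mn: "m \<ge> N" "n \<ge> N"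
    have "f m x - f n x = (f m x - f m y) + (f m y - f n y) + (f n y - f n x)" by simp
    then have "norm (f m x - f n x) \<le> norm (f m x - f m y) + norm (f m y - f n y) + norm (f n y - f n x)"
      by (simp only:) (rule order_trans[OF norm_triangle_ineq add_right_mono[OF norm_triangle_ineq]])
    also have "\<dots> < \<epsilon> / 3 + \<epsilon> / 3 + \<epsilon> / 3"
      using small[of m] small[of n] N[OF mn] by (simp add: norm_minus_commute)
    finally show "norm (f m x - f n x) < \<epsilon>" by simp
  qed
qed

text \<open>
  The potentials are determined up to constants and only locally bounded, so the diagonal argument is applied to
  the increments from 0 divided by \<open>1 + norm x\<close>, paired with the gradients. The two inequalities that
  characterize a convex function with nonexpansive gradient \<open>T\<close> are closed under pointwise limits, so no
  convergence of derivatives has to be discussed.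
\<close>
theorem smooth_convex_compactness:
  fixes \<phi> :: "nat \<Rightarrow> 'a::euclidean_space \<Rightarrow> real" and T :: "nat \<Rightarrow> 'a \<Rightarrow> 'a"
  assumes sub: "\<And>n x z. inner (T n x) z \<le> \<phi> n (x + z) - \<phi> n x"
    and smooth: "\<And>n x z. \<phi> n (x + z) - \<phi> n x - inner (T n x) z \<le> (norm z)\<^sup>2 / 2"
    and bdd: "\<And>n x. norm (T n x) \<le> R"
  obtains \<phi>' T' k where "strict_mono (k :: nat \<Rightarrow> nat)" "\<And>x. (\<lambda>n. T (k n) x) \<longlonglongrightarrow> T' x"
    "\<And>x z. inner (T' x) z \<le> \<phi>' (x + z) - \<phi>' x"
    "\<And>x z. \<phi>' (x + z) - \<phi>' x - inner (T' x) z \<le> (norm z)\<^sup>2 / 2"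
proof -
  have R0: "0 \<le> R" using bdd[of 0 0] norm_ge_zero order_trans by blast
  \<comment> \<open>Bounded subgradients make all potentials Lipschitz with the same constant.\<close>
  have philip: "\<bar>\<phi> n x - \<phi> n y\<bar> \<le> R * dist x y" for n x y
  proof -
    have *: "\<phi> n y - \<phi> n x \<le> R * dist x y" for x y
    proof -
      have "\<phi> n y - \<phi> n x \<le> inner (T n y) (y - x)" using sub[of n y "x - y"] by (simp add: inner_diff_right)
      also have "\<dots> \<le> norm (T n y) * norm (y - x)" by (rule norm_cauchy_schwarz)
      also have "\<dots> \<le> R * dist x y" by (simp add: dist_norm norm_minus_commute mult_right_mono bdd)
      finally show ?thesis .
    qed
    show ?thesis using *[of x y] *[of y x] by (simp add: dist_commute abs_le_iff)
  qed
  define f where "f n x = (T n x, (\<phi> n x - \<phi> n 0) / (1 + norm x))" for n x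
  have fb: "norm (f n x) \<le> R + R" for n x
  proof -
    have "\<bar>\<phi> n x - \<phi> n 0\<bar> \<le> R * (1 + norm x)"
      using philip[of n x 0] R0 by (simp add: dist_norm algebra_simps)
    then have "\<bar>(\<phi> n x - \<phi> n 0) / (1 + norm x)\<bar> \<le> R"
      by (simp add: abs_divide divide_le_eq add_pos_nonneg abs_of_nonneg)
    then show ?thesis
      unfolding f_def using norm_Pair_le[of "T n x" "(\<phi> n x - \<phi> n 0) / (1 + norm x)"] bdd[of n x] by simp
  qed
  obtain D :: "'a set" where D: "countable D" "\<And>X. open X \<Longrightarrow> X \<noteq> {} \<Longrightarrow> \<exists>d\<in>D. d \<in> X"
    using countable_dense_exists by blast
  have clD: "closure D = UNIV"
  proof (rule equalityI[OF subset_UNIV], rule subsetI)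
    fix x :: 'a
    show "x \<in> closure D" unfolding closure_approachable
      using D(2)[of "ball x _"] by (auto simp: dist_commute)
  qed
  obtain k :: "nat \<Rightarrow> nat" where k: "strict_mono k" "\<And>x. x \<in> D \<Longrightarrow> \<exists>l. (\<lambda>n. f (k n) x) \<longlonglongrightarrow> l"
    using function_convergent_subsequence[OF D(1), of f "R + R"] fb by blast
  have "convergent (\<lambda>n. T (k n) x)" for x
  proof (rule convergent_of_dense_equilipschitz[where L=1 and f = "\<lambda>n. T (k n)", OF _ clD])
    show "norm (T (k n) x - T (k n) y) \<le> 1 * dist x y" for n x y
      using gradient_nonexpansive[OF sub smooth, of "k n" x y] by (simp add: dist_norm)
    fix x assume "x \<in> D"
    then obtain l where "(\<lambda>n. f (k n) x) \<longlonglongrightarrow> l" using k(2) by blast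
    from tendsto_fst[OF this] show "convergent (\<lambda>n. T (k n) x)" by (auto simp: f_def convergent_def)
  qed
  then obtain T' where T': "\<And>x. (\<lambda>n. T (k n) x) \<longlonglongrightarrow> T' x" unfolding convergent_def by metis
  have "convergent (\<lambda>n. \<phi> (k n) x - \<phi> (k n) 0)" for x
  proof (rule convergent_of_dense_equilipschitz[where L=R and f = "\<lambda>n x. \<phi> (k n) x - \<phi> (k n) 0", OF _ clD])
    show "norm ((\<phi> (k n) x - \<phi> (k n) 0) - (\<phi> (k n) y - \<phi> (k n) 0)) \<le> R * dist x y" for n x y
      using philip[of "k n" x y] by simp
    fix x assume "x \<in> D"
    then obtain l where "(\<lambda>n. f (k n) x) \<longlonglongrightarrow> l" using k(2) by blast
    from tendsto_mult_right[OF tendsto_snd[OF this], of "1 + norm x"]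
    have "(\<lambda>n. \<phi> (k n) x - \<phi> (k n) 0) \<longlonglongrightarrow> snd l * (1 + norm x)"
      using norm_ge_zero[of x] by (simp add: f_def add_pos_nonneg less_imp_neq[symmetric] del: norm_ge_zero)
    then show "convergent (\<lambda>n. \<phi> (k n) x - \<phi> (k n) 0)" by (auto simp: convergent_def)
  qed
  then obtain \<phi>' where phi': "\<And>x. (\<lambda>n. \<phi> (k n) x - \<phi> (k n) 0) \<longlonglongrightarrow> \<phi>' x" unfolding convergent_def by metis
  have inc: "(\<lambda>n. \<phi> (k n) (x + z) - \<phi> (k n) x) \<longlonglongrightarrow> \<phi>' (x + z) - \<phi>' x" for x z
    using tendsto_diff[OF phi'[of "x + z"] phi'[of x]] by simp
  have Tz: "(\<lambda>n. inner (T (k n) x) z) \<longlonglongrightarrow> inner (T' x) z" for x z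
    by (intro tendsto_inner T' tendsto_const)
  show thesis
  proof (rule that[OF k(1) T'])
    show "inner (T' x) z \<le> \<phi>' (x + z) - \<phi>' x" for x z
      by (rule LIMSEQ_le[OF Tz inc]) (use sub in blast)
    show "\<phi>' (x + z) - \<phi>' x - inner (T' x) z \<le> (norm z)\<^sup>2 / 2" for x z
      by (rule LIMSEQ_le_const2[OF tendsto_diff[OF inc Tz]]) (use smooth in blast)
  qed
qed

text \<open>
  Indicators of closed sets are decreasing limits of Lipschitz functions of the distance, and closed sets form a
  generator that is stable under intersection.
\<close>
lemma prob_measure_eqI_lipschitz:
  fixes M N :: "'a::euclidean_space measure"
  assumes M: "prob_space M" "sets M = sets borel" and N: "prob_space N" "sets N = sets borel"
    and eq: "\<And>F L. (\<And>x y. \<bar>F x - F y\<bar> \<le> L * norm (x - y)) \<Longrightarrow> (\<And>x. 0 \<le> F x \<and> F x \<le> 1) \<Longrightarrow>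
      (\<integral>x. F x \<partial>M) = (\<integral>x. (F x :: real) \<partial>N)"
  shows "M = N"
proof -
  interpret M: prob_space M by fact
  interpret N: prob_space N by fact
  have sp: "space M = UNIV" "space N = UNIV"
    using sets_eq_imp_space_eq[OF M(2)] sets_eq_imp_space_eq[OF N(2)] by auto
  have closed_eq: "measure M A = measure N A" if A: "closed A" "A \<noteq> {}" for A
  proof -
    define F where "F k x = max 0 (1 - real k * infdist x A)" for k x
    have lip: "\<bar>F k x - F k y\<bar> \<le> real k * norm (x - y)" for k x y
    proof -
      have "\<bar>F k x - F k y\<bar> \<le> \<bar>real k * infdist x A - real k * infdist y A\<bar>" unfolding F_def by linarith
      also have "\<dots> = real k * \<bar>infdist x A - infdist y A\<bar>" by (simp add: abs_mult flip: right_diff_distrib)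
      also have "\<dots> \<le> real k * norm (x - y)"
        using infdist_triangle_abs[of x A y] by (intro mult_left_mono) (auto simp: dist_norm)
      finally show ?thesis .
    qed
    have rng: "0 \<le> F k x \<and> F k x \<le> 1" for k x unfolding F_def by (simp add: infdist_nonneg)
    have Fm: "F k \<in> borel_measurable borel" for k
    proof (rule borel_measurable_continuous_onI)
      show "continuous_on UNIV (F k)" unfolding F_def by (intro continuous_intros)
    qed
    have lim: "(\<lambda>k. F k x) \<longlonglongrightarrow> indicator A x" for x
    proof (cases "x \<in> A")
      case True
      then show ?thesis by (simp add: F_def)
    next
      case False
      then have pos: "infdist x A > 0"
        using A in_closed_iff_infdist_zero[OF A] infdist_nonneg[of x A] by (metis less_le)
      obtain n where n: "1 < real n * infdist x A" using reals_Archimedean3[OF pos] by blast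
      have "\<forall>\<^sub>F k in sequentially. F k x = indicator A x"
        unfolding eventually_sequentially
      proof (intro exI[of _ n] allI impI)
        fix k assume "n \<le> k"
        then have "real n * infdist x A \<le> real k * infdist x A" using pos by (intro mult_right_mono) auto
        then show "F k x = indicator A x" using n False by (simp add: F_def)
      qed
      then show ?thesis by (rule tendsto_eventually)
    qed
    have conv: "(\<lambda>k. \<integral>x. F k x \<partial>P) \<longlonglongrightarrow> measure P A" if "prob_space P" "sets P = sets borel" for P
    proof -
      interpret prob_space P by fact
      have [measurable_cong]: "sets P = sets borel" by fact
      have [measurable]: "A \<in> sets borel" using A by simp
      have "(\<lambda>k. \<integral>x. F k x \<partial>P) \<longlonglongrightarrow> (\<integral>x. indicator A x \<partial>P)"
      proof (rule integral_dominated_convergence[where w = "\<lambda>_. 1"])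
        show "F k \<in> borel_measurable P" for k using Fm that by (simp cong: measurable_cong_sets)
      qed (use rng lim in auto)
      also have "(\<integral>x. indicator A x \<partial>P) = measure P A"
        using that sets_eq_imp_space_eq[OF that(2)] by simp
      finally show ?thesis .
    qed
    have "(\<lambda>k. \<integral>x. F k x \<partial>M) = (\<lambda>k. \<integral>x. F k x \<partial>N)" using eq[OF lip rng] by blast
    then show ?thesis using conv[OF M] conv[OF N] LIMSEQ_unique by metis
  qed
  have em: "emeasure M A = emeasure N A" if "closed A" for A
    using closed_eq[OF that] by (cases "A = {}") (auto simp: M.emeasure_eq_measure N.emeasure_eq_measure)
  show ?thesis
  proof (rule measure_eqI_generator_eq[where E = "Collect closed" and \<Omega> = UNIV and A = "\<lambda>_. UNIV"])
    show "Int_stable (Collect (closed :: 'a set \<Rightarrow> bool))" by (auto simp: Int_stable_def)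
    show "sets M = sigma_sets UNIV (Collect closed)" "sets N = sigma_sets UNIV (Collect closed)"
      using M(2) N(2) by (simp_all add: borel_eq_closed)
  qed (use em in auto)
qed

text \<open>
  The limit of vanishing temperature, with the permitted error in the second marginal equal to the temperature.
\<close>
theorem contraction_transport:
  fixes \<mu> \<nu> :: "'a::euclidean_space measure"
  assumes pair: "\<And>e. e > 0 \<Longrightarrow> contraction_pair \<mu> \<nu> m w U R e"
  shows "\<exists>\<phi> T. convex_on UNIV \<phi> \<and> (\<forall>x. GDERIV \<phi> x :> T x) \<and> continuous_on UNIV T \<and>
    1-lipschitz_on UNIV T \<and> \<nu> = distr \<mu> borel T"
proof -
  define e where "e n = 1 / real (Suc n)" for n
  have epos: "e n > 0" for n by (simp add: e_def)
  have e0: "e \<longlonglongrightarrow> 0" unfolding e_def using LIMSEQ_inverse_real_of_nat by (simp add: inverse_eq_divide)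
  interpret contraction_pair \<mu> \<nu> m w U R 1 by (rule pair) simp
  let ?C = "real (16 * DIM('a) + 1)"
  have "\<exists>\<phi> T. (\<forall>x z. inner (T x) z \<le> \<phi> (x + z) - \<phi> x) \<and>
    (\<forall>x z. \<phi> (x + z) + \<phi> (x - z) - 2 * \<phi> x \<le> (norm z)\<^sup>2) \<and> (\<forall>x. norm (T x) \<le> R) \<and>
    (\<forall>F L B. (\<forall>x y. \<bar>F x - F y\<bar> \<le> L * norm (x - y)) \<longrightarrow> (\<forall>x. \<bar>F x\<bar> \<le> B) \<longrightarrow>
      \<bar>(\<integral>x. F (T x) \<partial>\<mu>) - (\<integral>y. F y \<partial>\<nu>)\<bar> \<le> L * (?C * sqrt (e n)) + B * e n)" for n
    using contraction_pair.ex_approximate_map[OF pair[OF epos[of n]] epos[of n]] .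
  then obtain \<phi> T where sub: "\<And>n x z. inner (T n x) z \<le> \<phi> n (x + z) - \<phi> n x"
    and diff2: "\<And>n x z. \<phi> n (x + z) + \<phi> n (x - z) - 2 * \<phi> n x \<le> (norm z)\<^sup>2"
    and bdd: "\<And>n x. norm (T n x) \<le> R"
    and test: "\<And>n F L B. (\<And>x y. \<bar>F x - F y\<bar> \<le> L * norm (x - y)) \<Longrightarrow> (\<And>x. \<bar>F x\<bar> \<le> B) \<Longrightarrow>
      \<bar>(\<integral>x. F (T n x) \<partial>\<mu>) - (\<integral>y. F y \<partial>\<nu>)\<bar> \<le> L * (?C * sqrt (e n)) + B * e n"
    by metis
  have smooth: "\<phi> n (x + z) - \<phi> n x - inner (T n x) z \<le> (norm z)\<^sup>2 / 2" for n x z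
    by (rule smooth_of_second_difference[OF sub diff2])
  have cont: "continuous_on UNIV S" if "\<And>x y. norm (S x - S y) \<le> norm (x - y)" for S :: "'a \<Rightarrow> 'a"
    using that by (intro lipschitz_on_continuous_on[where L=1] lipschitz_onI) (auto simp: dist_norm)
  obtain \<phi>' T' and k :: "nat \<Rightarrow> nat" where k: "strict_mono k" and T': "\<And>x. (\<lambda>n. T (k n) x) \<longlonglongrightarrow> T' x"
    and sub': "\<And>x z. inner (T' x) z \<le> \<phi>' (x + z) - \<phi>' x"
    and smooth': "\<And>x z. \<phi>' (x + z) - \<phi>' x - inner (T' x) z \<le> (norm z)\<^sup>2 / 2"
    by (rule smooth_convex_compactness[where T = T and \<phi> = \<phi>, OF sub smooth bdd]) blast
  have lip': "norm (T' x - T' y) \<le> norm (x - y)" for x y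
    by (rule gradient_nonexpansive[OF sub' smooth'])
  have Tm: "T n \<in> borel_measurable borel" for n
    using cont[OF gradient_nonexpansive[OF sub smooth]] by (rule borel_measurable_continuous_onI)
  have T'm: "T' \<in> borel_measurable borel"
    using cont[OF lip'] by (rule borel_measurable_continuous_onI)
  have "distr \<mu> borel T' = \<nu>"
  proof (rule prob_measure_eqI_lipschitz)
    show "prob_space (distr \<mu> borel T')" using T'm by (intro mu.prob_space_distr) simp
    fix F :: "'a \<Rightarrow> real" and L
    assume L: "\<And>x y. \<bar>F x - F y\<bar> \<le> L * norm (x - y)" and F: "\<And>x. 0 \<le> F x \<and> F x \<le> 1"
    have cF: "continuous_on UNIV F" using lipschitz_function_regularity[OF L] by auto
    then have [measurable]: "F \<in> borel_measurable borel" by (rule borel_measurable_continuous_onI)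
    note [measurable] = Tm T'm
    have "(\<lambda>n. \<integral>x. F (T (k n) x) \<partial>\<mu>) \<longlonglongrightarrow> (\<integral>x. F (T' x) \<partial>\<mu>)"
    proof (rule integral_dominated_convergence[where w = "\<lambda>_. 1"])
      have "(\<lambda>n. F (T (k n) x)) \<longlonglongrightarrow> F (T' x)" for x
        by (rule continuous_on_tendsto_compose[OF cF T']) auto
      then show "AE x in \<mu>. (\<lambda>n. F (T (k n) x)) \<longlonglongrightarrow> F (T' x)" by simp
    qed (use F in auto)
    moreover have "(\<lambda>n. \<integral>x. F (T (k n) x) \<partial>\<mu>) \<longlonglongrightarrow> (\<integral>y. F y \<partial>\<nu>)"
    proof -
      have ek: "(\<lambda>n. e (k n)) \<longlonglongrightarrow> 0" using LIMSEQ_subseq_LIMSEQ[OF e0 k] by (simp add: o_def)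
      have "(\<lambda>n. L * (?C * sqrt (e (k n))) + 1 * e (k n)) \<longlonglongrightarrow> L * (?C * sqrt 0) + 1 * 0"
        by (intro tendsto_intros ek)
      then have bound0: "(\<lambda>n. L * (?C * sqrt (e (k n))) + 1 * e (k n)) \<longlonglongrightarrow> 0" by simp
      have "norm ((\<integral>x. F (T (k n) x) \<partial>\<mu>) - (\<integral>y. F y \<partial>\<nu>)) \<le> L * (?C * sqrt (e (k n))) + 1 * e (k n)" for n
        unfolding real_norm_def by (rule test[OF L]) (use F in auto)
      then have "(\<lambda>n. (\<integral>x. F (T (k n) x) \<partial>\<mu>) - (\<integral>y. F y \<partial>\<nu>)) \<longlonglongrightarrow> 0"
        by (intro Lim_null_comparison[OF _ bound0] always_eventually allI)
      then show ?thesis by (rule LIM_zero_cancel)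
    qed
    ultimately have "(\<integral>x. F (T' x) \<partial>\<mu>) = (\<integral>y. F y \<partial>\<nu>)" by (rule LIMSEQ_unique)
    then show "(\<integral>x. F x \<partial>distr \<mu> borel T') = (\<integral>y. F y \<partial>\<nu>)"
      by (subst integral_distr) auto
  qed (use prob_nu in auto)
  moreover have "1-lipschitz_on UNIV T'" by (rule lipschitz_onI) (use lip' in \<open>auto simp: dist_norm\<close>)
  ultimately show ?thesis
    using convex_on_of_subgradient[OF sub'] gderiv_of_quadratic_bound[OF sub' smooth'] cont[OF lip'] by blast
qed

section \<open>Gaussian densities with extended-valued exponents\<close>

text \<open>
  An extended-valued convex function may fail to be Borel measurable on the boundary of its domain, so the functions
  here are arbitrary; the lemma serves to replace such a density by a measurable one.
\<close>
lemma density_cong_AE_nonmeasurable: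
  assumes "AE x in M. f x = g x"
  shows "density M f = density M g"
  unfolding density_def
proof (rule measure_of_eq)
  show "sets M \<subseteq> Pow (space M)" by (rule sets.space_closed)
  fix A assume "A \<in> sigma_sets (space M) (sets M)"
  show "(\<integral>\<^sup>+x. f x * indicator A x \<partial>M) = (\<integral>\<^sup>+x. g x * indicator A x \<partial>M)"
    by (rule nn_integral_cong_AE) (use assms in \<open>auto elim!: eventually_mono\<close>)
qed

text \<open>
  For a non-measurable \<open>f\<close> the set function underlying the density need not be a measure, in which case the
  density is the zero measure. A total mass of 1 excludes this.
\<close>
lemma nn_integral_of_prob_density:
  assumes "prob_space (density M f)"
  shows "(\<integral>\<^sup>+x. f x \<partial>M) = 1"
proof -
  have one: "emeasure (density M f) (space M) = 1"
    using prob_space.emeasure_space_1[OF assms] by simp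
  have "emeasure (density M f) (space M) \<in> {\<integral>\<^sup>+x. f x * indicator (space M) x \<partial>M, 0}"
    unfolding density_def by (simp add: emeasure_measure_of_conv)
  with one have "(\<integral>\<^sup>+x. f x * indicator (space M) x \<partial>M) = 1" by auto
  moreover have "(\<integral>\<^sup>+x. f x * indicator (space M) x \<partial>M) = (\<integral>\<^sup>+x. f x \<partial>M)"
    by (intro nn_integral_cong) auto
  ultimately show ?thesis by simp
qed

lemma ext_convex_finite_part:
  assumes "ext_convex f"
  shows "convex {x. f x \<noteq> \<infinity>}" and "convex_on {x. f x \<noteq> \<infinity>} (\<lambda>x. real_of_ereal (f x))"
proof -
  have fin: "f x = ereal (real_of_ereal (f x))" if "f x \<noteq> \<infinity>" for x
    using assms that by (cases "f x") (auto simp: ext_convex_def)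
  have le: "f ((1 - t) *\<^sub>R x + t *\<^sub>R y) \<le> ereal ((1 - t) * real_of_ereal (f x) + t * real_of_ereal (f y))"
    if "f x \<noteq> \<infinity>" "f y \<noteq> \<infinity>" "0 < t" "t < 1" for x y t
  proof -
    have "f ((1 - t) *\<^sub>R x + t *\<^sub>R y) \<le> ereal (1 - t) * f x + ereal t * f y"
      using assms that by (auto simp: ext_convex_def)
    also have "\<dots> = ereal ((1 - t) * real_of_ereal (f x) + t * real_of_ereal (f y))"
      by (subst fin[OF that(1)], subst fin[OF that(2)]) simp
    finally show ?thesis .
  qed
  show conv: "convex {x. f x \<noteq> \<infinity>}"
    unfolding convex_alt
  proof (intro ballI allI impI)
    fix x y and t :: real assume xy: "x \<in> {x. f x \<noteq> \<infinity>}" "y \<in> {x. f x \<noteq> \<infinity>}" and t: "0 \<le> t \<and> t \<le> 1"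
    show "(1 - t) *\<^sub>R x + t *\<^sub>R y \<in> {x. f x \<noteq> \<infinity>}"
    proof (cases "t = 0 \<or> t = 1")
      case False
      then show ?thesis using le[of x y t] xy t by auto
    qed (use xy in auto)
  qed
  show "convex_on {x. f x \<noteq> \<infinity>} (\<lambda>x. real_of_ereal (f x))"
  proof (rule convex_onI[OF _ conv])
    fix t :: real and x y assume t: "0 < t" "t < 1" and xy: "x \<in> {x. f x \<noteq> \<infinity>}" "y \<in> {x. f x \<noteq> \<infinity>}"
    have l: "f ((1 - t) *\<^sub>R x + t *\<^sub>R y) \<le> ereal ((1 - t) * real_of_ereal (f x) + t * real_of_ereal (f y))"
      using le xy t by simp
    then have "f ((1 - t) *\<^sub>R x + t *\<^sub>R y) \<noteq> \<infinity>" by auto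
    from fin[OF this] l show "real_of_ereal (f ((1 - t) *\<^sub>R x + t *\<^sub>R y)) \<le> (1 - t) * real_of_ereal (f x) + t * real_of_ereal (f y)"
      by (metis ereal_less_eq(3))
  qed
qed

lemma convex_on_second_difference:
  fixes f :: "'a::real_vector \<Rightarrow> real"
  assumes "convex_on S f" "x + u \<in> S" "x - u \<in> S"
  shows "0 \<le> f (x + u) + f (x - u) - 2 * f x"
proof -
  have "(1 - 1/2) *\<^sub>R (x + u) + (1/2) *\<^sub>R (x - u) = (1/2) *\<^sub>R (x + x)"
    by (simp add: scaleR_add_right scaleR_diff_right)
  also have "\<dots> = x" by (simp add: scaleR_half_double)
  finally have "f x \<le> (1 - 1/2) * f (x + u) + (1/2) * f (x - u)"
    using convex_onD[OF assms(1), of "1/2" "x + u" "x - u"] assms by simp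
  then show ?thesis by simp
qed

text \<open>
  The negative logarithm of the standard Gaussian density. Absorbing the normalizing constant into the exponent does
  not affect second differences.
\<close>
definition gaussian_potential :: "real ^ 'n \<Rightarrow> real" where
  "gaussian_potential x = (norm x)\<^sup>2 / 2 + real CARD('n) * ln (sqrt (2 * pi))"

lemma std_gaussian_eq: "std_gaussian = density lborel (\<lambda>x :: real ^ 'n. ennreal (exp (- gaussian_potential x)))"
proof -
  have "exp (- (norm x)\<^sup>2 / 2) / sqrt (2 * pi) ^ CARD('n) = exp (- gaussian_potential x)" for x :: "real ^ 'n"
  proof -
    have "sqrt (2 * pi) ^ CARD('n) = exp (real CARD('n) * ln (sqrt (2 * pi)))"
      by (simp add: exp_of_nat_mult)
    moreover have "- gaussian_potential x = - (norm x)\<^sup>2 / 2 - real CARD('n) * ln (sqrt (2 * pi))"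
      by (simp add: gaussian_potential_def)
    ultimately show ?thesis by (simp only: exp_diff)
  qed
  then show ?thesis unfolding std_gaussian_def by simp
qed

lemma gaussian_potential_measurable [measurable]: "gaussian_potential \<in> borel_measurable borel"
  unfolding gaussian_potential_def by (intro borel_measurable_continuous_onI continuous_intros) simp

lemma gaussian_potential_second_difference:
  "gaussian_potential (x + u) + gaussian_potential (x - u) - 2 * gaussian_potential x = (norm u)\<^sup>2"
  using square_norm_second_difference[of x u] by (simp add: gaussian_potential_def)

lemma AE_std_gaussian_iff: "(AE x in std_gaussian. P x) \<longleftrightarrow> (AE x in (lborel :: (real ^ 'n) measure). P x)"
  unfolding std_gaussian_eq by (subst AE_density) auto

text \<open>
  If \<open>V\<close> were infinite at a point, a hyperplane separating this point from the convex domain of \<open>V\<close> would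
  bound an open half-space on which \<open>V\<close> is infinite, and the density would have infinite mass.
\<close>
lemma finite_of_prob_density:
  fixes V :: "real ^ 'n \<Rightarrow> ereal"
  assumes V: "ext_convex V" and prob: "prob_space (density std_gaussian (\<lambda>x. exp_ereal (V x)))"
  shows "V y \<noteq> \<infinity>"
proof
  assume y: "V y = \<infinity>"
  let ?C = "{x. V x \<noteq> \<infinity>}"
  obtain H where H: "open H" "H \<noteq> {}" "H \<inter> ?C = {}"
  proof (cases "?C = {}")
    case True
    then show ?thesis using that[of UNIV] by auto
  next
    case False
    have "?C \<inter> {y} = {}" using y by auto
    then obtain a b where ab: "a \<noteq> 0" "\<forall>x\<in>?C. inner a x \<le> b"
      using separating_hyperplane_sets[OF ext_convex_finite_part(1)[OF V] convex_singleton[of y] False] by auto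
    show ?thesis
    proof (rule that[of "{x. inner a x > b}"])
      show "open {x. inner a x > b}" by (rule open_halfspace_gt)
      have "inner a (((b + 1) / inner a a) *\<^sub>R a) = b + 1" using ab(1) by simp
      then have "((b + 1) / inner a a) *\<^sub>R a \<in> {x. inner a x > b}" by simp
      then show "{x. inner a x > b} \<noteq> {}" by blast
      show "{x. inner a x > b} \<inter> ?C = {}" using ab(2) by fastforce
    qed
  qed
  have [measurable]: "H \<in> sets borel" using H by simp
  have "emeasure std_gaussian H \<noteq> 0"
  proof
    assume "emeasure std_gaussian H = 0"
    then have "AE x in std_gaussian. x \<notin> H" by (subst AE_iff_null_sets[symmetric]) (auto simp: null_sets_def std_gaussian_def)
    then have "H \<in> null_sets lborel" by (simp add: AE_std_gaussian_iff AE_iff_null_sets)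
    then show False using open_notin_null_sets_lborel H by blast
  qed
  then have "\<infinity> = \<infinity> * emeasure std_gaussian H" by (simp add: ennreal_top_mult)
  also have "\<dots> = (\<integral>\<^sup>+x. \<infinity> * indicator H x \<partial>std_gaussian)"
    by (subst nn_integral_cmult_indicator) (auto simp: std_gaussian_def)
  also have "\<dots> \<le> (\<integral>\<^sup>+x. exp_ereal (V x) \<partial>std_gaussian)"
  proof (rule nn_integral_mono)
    fix x :: "real ^ 'n"
    show "\<infinity> * indicator H x \<le> exp_ereal (V x)"
      using H(3) by (cases "x \<in> H") (auto simp: exp_ereal_def)
  qed
  also have "\<dots> = 1" by (rule nn_integral_of_prob_density[OF prob])
  finally show False by (simp add: top_unique)
qed

lemma log_convex_density:
  fixes V :: "real ^ 'n \<Rightarrow> ereal"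
  assumes V: "ext_convex V" and prob: "prob_space (density std_gaussian (\<lambda>x. exp_ereal (V x)))"
  obtains m where "m \<in> borel_measurable borel"
    "density std_gaussian (\<lambda>x. exp_ereal (V x)) = density lborel (\<lambda>x. ennreal (exp (- m x)))"
    "\<And>x u. m (x + u) + m (x - u) - 2 * m x \<le> (norm u)\<^sup>2"
proof -
  define v where "v x = real_of_ereal (V x)" for x
  have fin: "V x \<noteq> \<infinity>" for x by (rule finite_of_prob_density[OF assms])
  have Vv: "V x = ereal (v x)" for x
    using fin[of x] V by (cases "V x") (auto simp: ext_convex_def v_def)
  have conv: "convex_on UNIV v" using ext_convex_finite_part(2)[OF V] fin by (simp add: v_def[abs_def])
  have [measurable]: "v \<in> borel_measurable borel"
    by (rule borel_measurable_continuous_onI) (rule convex_on_continuous[OF open_UNIV conv])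
  show thesis
  proof (rule that[of "\<lambda>x. gaussian_potential x - v x"])
    show "density std_gaussian (\<lambda>x. exp_ereal (V x)) = density lborel (\<lambda>x. ennreal (exp (- (gaussian_potential x - v x))))"
      unfolding std_gaussian_eq Vv exp_ereal_def
      by (subst density_density_eq) (auto simp: ennreal_mult[symmetric] exp_add[symmetric] intro!: density_cong)
    show "(gaussian_potential (x + u) - v (x + u)) + (gaussian_potential (x - u) - v (x - u)) - 2 * (gaussian_potential x - v x) \<le> (norm u)\<^sup>2" for x u
      using gaussian_potential_second_difference[of x u] convex_on_second_difference[OF conv, of x u]
      by (simp add: algebra_simps)
  qed measurable
qed

text \<open>
  Outside the frontier of its domain, which is a null set by convexity, \<open>W\<close> is either infinite or finite and
  continuous; \<open>U\<close> is the interior of the domain.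
\<close>
lemma log_concave_density:
  fixes W :: "real ^ 'n \<Rightarrow> ereal"
  assumes W: "ext_convex W"
  obtains w U where "w \<in> borel_measurable borel" "open U" "convex U"
    "density std_gaussian (\<lambda>x. exp_ereal (- W x)) = density lborel (\<lambda>y. indicator U y * ennreal (exp (- w y)))"
    "\<And>y u. y + u \<in> U \<Longrightarrow> y - u \<in> U \<Longrightarrow> (norm u)\<^sup>2 \<le> w (y + u) + w (y - u) - 2 * w y"
proof -
  let ?D = "{x. W x \<noteq> \<infinity>}"
  define U where "U = interior ?D"
  define w0 where "w0 x = real_of_ereal (W x)" for x
  define w where "w x = indicator U x * w0 x" for x
  have U: "open U" "convex U" "U \<subseteq> ?D"
    using ext_convex_finite_part(1)[OF W] by (simp_all add: U_def convex_interior interior_subset)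
  have [measurable]: "U \<in> sets borel" using U by simp
  have conv: "convex_on U w0"
    using convex_on_subset[OF ext_convex_finite_part(2)[OF W] U(3) U(2)] by (simp add: w0_def[abs_def])
  have [measurable]: "w \<in> borel_measurable borel"
    using borel_measurable_continuous_on_indicator[OF _ convex_on_continuous[OF U(1) conv]] U
    by (simp add: w_def[abs_def])
  have "frontier ?D \<in> null_sets lborel"
    using negligible_convex_frontier[OF ext_convex_finite_part(1)[OF W]]
    by (simp add: negligible_iff_null_sets null_sets_completion_iff)
  then have "AE x in std_gaussian. x \<notin> frontier ?D"
    by (simp add: AE_std_gaussian_iff AE_not_in)
  then have "AE x in std_gaussian. exp_ereal (- W x) = indicator U x * ennreal (exp (- w x))"
  proof (rule eventually_mono)
    fix x assume x: "x \<notin> frontier ?D"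
    show "exp_ereal (- W x) = indicator U x * ennreal (exp (- w x))"
    proof (cases "x \<in> ?D")
      case True
      then have "x \<in> U" using x closure_subset[of ?D] by (auto simp: U_def frontier_def)
      moreover have "W x = ereal (w0 x)"
        using True W by (cases "W x") (auto simp: ext_convex_def w0_def)
      ultimately show ?thesis by (simp add: exp_ereal_def w_def)
    next
      case False
      then have "x \<notin> U" using U(3) by blast
      with False show ?thesis by (simp add: exp_ereal_def)
    qed
  qed
  then have "density std_gaussian (\<lambda>x. exp_ereal (- W x)) = density std_gaussian (\<lambda>x. indicator U x * ennreal (exp (- w x)))"
    by (rule density_cong_AE_nonmeasurable[where M = std_gaussian and f = "\<lambda>x. exp_ereal (- W x)"])
  also have "\<dots> = density lborel (\<lambda>y. indicator U y * ennreal (exp (- (gaussian_potential y + w y))))"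
    unfolding std_gaussian_eq
    by (subst density_density_eq)
      (auto simp: mult.left_commute ennreal_mult[symmetric] exp_add[symmetric] intro!: density_cong)
  finally have eq: "density std_gaussian (\<lambda>x. exp_ereal (- W x)) = density lborel (\<lambda>y. indicator U y * ennreal (exp (- (gaussian_potential y + w y))))" .
  show thesis
  proof (rule that[OF _ U(1,2) eq])
    fix y u assume yu: "y + u \<in> U" "y - u \<in> U"
    have "y \<in> U" using convex_midpoint[OF U(2) yu] .
    then show "(norm u)\<^sup>2 \<le> (gaussian_potential (y + u) + w (y + u)) + (gaussian_potential (y - u) + w (y - u)) - 2 * (gaussian_potential y + w y)"
      using gaussian_potential_second_difference[of y u] convex_on_second_difference[OF conv yu] yu
      by (simp add: w_def algebra_simps)
  qed measurable
qed

text \<open>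
  Together with compactness of the support this makes \<open>U\<close> bounded.
\<close>
lemma subset_measure_support:
  fixes U :: "'a::euclidean_space set"
  assumes [measurable]: "w \<in> borel_measurable borel" and U: "open U"
  shows "U \<subseteq> measure_support (density lborel (\<lambda>y. indicator U y * ennreal (exp (- w y))))"
    (is "_ \<subseteq> measure_support ?N")
  unfolding measure_support_def
proof (intro subsetI CollectI allI impI)
  fix y S assume y: "y \<in> U" and S: "open S \<and> y \<in> S"
  have [measurable]: "U \<in> sets borel" "S \<in> sets borel" using U S by auto
  show "0 < emeasure ?N S"
  proof (rule ccontr)
    assume "\<not> 0 < emeasure ?N S"
    then have "S \<in> null_sets ?N" by (simp add: null_sets_def)
    then have "AE x in ?N. x \<notin> S" by (rule AE_not_in)
    then have "AE x in lborel. x \<notin> U \<inter> S"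
      by (subst (asm) AE_density) (auto simp: indicator_def elim!: eventually_mono)
    then have "U \<inter> S \<in> null_sets lborel" by (subst AE_iff_null_sets) auto
    then show False using open_notin_null_sets_lborel[of "U \<inter> S"] U S y by auto
  qed
qed

theorem theorem1:
  fixes V W :: "real ^ 'n \<Rightarrow> ereal"
    and \<mu> \<nu> :: "(real ^ 'n) measure"
  assumes "ext_convex V"
    and "ext_convex W"
    and "\<mu> = density std_gaussian (\<lambda>x. exp_ereal (V x))"
    and "\<nu> = density std_gaussian (\<lambda>x. exp_ereal (- W x))"
    and "prob_space \<mu>"
    and "prob_space \<nu>"
    and "integrable \<mu> (\<lambda>x. (norm x)\<^sup>2)"
    and "compact (measure_support \<nu>)"
  shows "\<exists>(\<phi> :: real ^ 'n \<Rightarrow> real) (g :: real ^ 'n \<Rightarrow> real ^ 'n).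
           convex_on UNIV \<phi> \<and>
           (\<forall>x. GDERIV \<phi> x :> g x) \<and>
           continuous_on UNIV g \<and>
           1-lipschitz_on UNIV g \<and>
           \<nu> = distr \<mu> borel g"
proof -
  obtain m where m: "m \<in> borel_measurable borel" "\<mu> = density lborel (\<lambda>x. ennreal (exp (- m x)))"
    "\<And>x u. m (x + u) + m (x - u) - 2 * m x \<le> (norm u)\<^sup>2"
    by (rule log_convex_density[OF assms(1) assms(5)[unfolded assms(3)], folded assms(3)]) blast
  obtain w U where w: "w \<in> borel_measurable borel" "open U" "convex U"
    "\<nu> = density lborel (\<lambda>y. indicator U y * ennreal (exp (- w y)))"
    "\<And>y u. y + u \<in> U \<Longrightarrow> y - u \<in> U \<Longrightarrow> (norm u)\<^sup>2 \<le> w (y + u) + w (y - u) - 2 * w y"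
    by (rule log_concave_density[OF assms(2), folded assms(4)]) blast
  obtain R where R: "\<And>y. y \<in> measure_support \<nu> \<Longrightarrow> norm y \<le> R"
    using compact_imp_bounded[OF assms(8)] by (auto simp: bounded_iff)
  have UR: "norm y \<le> R" if "y \<in> U" for y
    using R subset_measure_support[OF w(1,2)] that unfolding w(4) by blast
  have moment: "integrable \<mu> (\<lambda>x. x)"
  proof (rule Bochner_Integration.integrable_bound)
    interpret prob_space \<mu> by fact
    show "integrable \<mu> (\<lambda>x. 1 + (norm x)\<^sup>2)" using assms(7) by auto
    show "(\<lambda>x. x) \<in> borel_measurable \<mu>" unfolding m(2) by simp
    have "norm x \<le> 1 + (norm x)\<^sup>2" for x :: "real ^ 'n"
    proof -
      have "2 * norm x \<le> 1 + (norm x)\<^sup>2"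
        using zero_le_power2[of "norm x - 1"] by (simp add: power2_eq_square algebra_simps)
      with norm_ge_zero[of x] show ?thesis by linarith
    qed
    then show "AE x in \<mu>. norm x \<le> norm (1 + (norm x)\<^sup>2)"
      by (intro AE_I2) (simp add: abs_of_nonneg)
  qed
  show ?thesis
  proof (rule contraction_transport)
    fix e :: real assume "0 < e"
    with assms(5,6) m w UR moment show "contraction_pair \<mu> \<nu> m w U R e"
      by (intro contraction_pair.intro)
  qed
qed

end
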